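(* Let $\mathcal{H}$ be a proper subgroup, of order $H$, of a finite abelian group $\mathcal{G}$ of order $G$. Let $\mathcal{A}$ be a subset of $\mathcal{G}$ with $\#(\mathcal{A})=S=\frac{G}{H}-1$. Let $\{\boldsymbol{\xi}_\gamma\}_{\gamma\in\hat{\mathcal{G}}}\subseteq\mathbb{C}^{\mathcal{A}}$, $\boldsymbol{\xi}_\gamma(a):=\frac{1}{\sqrt{S}}\gamma(a)$. Then the following are equivalent: (i) $\mathcal{A}$ is a simplicial $\mathcal{H}$-RDS for $\mathcal{G}$. (ii) $(\mathbf{F}^*\chi_{\mathcal{A}})(\gamma)=-1$ for all $\gamma\in\mathcal{H}^\perp$, $\gamma\neq1$, while $|(\mathbf{F}^*\chi_{\mathcal{A}})(\gamma)|=\sqrt{S}$ for all $\gamma\notin\mathcal{H}^\perp$. (iii) For each $\gamma\in\hat{\mathcal{G}}$, $\{\boldsymbol{\xi}_{\gamma'}\}_{\gamma'\in\gamma\mathcal{H}^\perp}$ is a regular $S$-simplex whose vectors sum to zero, and moreover these simplices are mutually unbiased in the sense that $|\langle\boldsymbol{\xi}_\gamma,\boldsymbol{\xi}_{\gamma'}\rangle|$ is constant over all $\gamma,\gamma'\in\hat{\mathcal{G}}$ with $\overline{\gamma}\neq\overline{\gamma}'$. Moreover, in this case, $|\langle\boldsymbol{\xi}_\gamma,\boldsymbol{\xi}_{\gamma'}\rangle|=\frac{1}{\sqrt{S}}$ whenever $\overline{\gamma}\neq\overline{\gamma}'$, and for any $\gamma\notin\mathcal{H}^\perp$, $$\hat{\mathbf{C}}_\gamma\in\mathbb{C}^{(\mathcal{G}/\mathcal{H})\times(\mathcal{G}/\mathcal{H})},\qquad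 \hat{\mathbf{C}}_\gamma(\overline{g},\overline{g}'):=\sum_{a\in\mathcal{A},\,\overline{a}=\overline{g}-\overline{g}'}\gamma(a),$$ is a circulant conference matrix. In the special case where $\mathcal{A}$ arises from a composite difference set $\mathcal{D}$ for $\mathcal{G}$ (that is, $\mathcal{D}$ is $\mathcal{H}$-fine and $\chi_{\mathcal{D}}=\chi_{\mathcal{A}}*\chi_{\mathcal{B}}$ for some difference set $\mathcal{B}$ for $\mathcal{H}$), for every $\gamma\notin\mathcal{H}^\perp$ the matrix $\hat{\mathbf{C}}_\gamma$ is a unimodular scalar multiple of the matrix $\mathbf{C}_\gamma\in\mathbb{C}^{(\mathcal{G}/\mathcal{H})\times(\mathcal{G}/\mathcal{H})}$ given by $$\mathbf{C}_\gamma(\overline{g},\overline{g}')=\frac{S^{3/2}}{D}\sum_{d\in\mathcal{D},\,\overline{d}=\overline{g}-\overline{g}'}\gamma(d),\qquad D=\#(\mathcal{D}).$$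
   Context: Groups $\mathcal{G}$ are written additively. $\hat{\mathcal{G}}$ is the multiplicative group of characters $\gamma:\mathcal{G}\to\{z\in\mathbb{C}:|z|=1\}$, with identity $1$; $\mathcal{H}^\perp=\{\gamma\in\hat{\mathcal{G}}:\gamma(h)=1\ \forall h\in\mathcal{H}\}$; cosets are written $\overline{g}=g+\mathcal{H}$ and $\overline{\gamma}=\gamma\mathcal{H}^\perp$. For $\mathbf{x}:\mathcal{G}\to\mathbb{C}$, $(\mathbf{F}^*\mathbf{x})(\gamma)=\sum_{g\in\mathcal{G}}\overline{\gamma(g)}\,\mathbf{x}(g)$, where the bar on $\gamma(g)$ denotes complex conjugation. $\chi_{\mathcal{X}}$ is the characteristic function of $\mathcal{X}\subseteq\mathcal{G}$, and $(\mathbf{x}_1*\mathbf{x}_2)(g)=\sum_{g'\in\mathcal{G}}\mathbf{x}_1(g')\mathbf{x}_2(g-g')$. Inner products on $\mathbb{C}^{\mathcal{A}}$ are standard and conjugate-linear in the first argument. A subset $\mathcal{A}$ of $\mathcal{G}$ is an $\mathcal{H}$-relative difference set ($\mathcal{H}$-RDS) for $\mathcal{G}$ if no nonzero member of $\mathcal{H}$ is a difference of two members of $\mathcal{A}$, while every $g\in\mathcal{G}\setminus\mathcal{H}$ can be written as a difference $a-a'$ of members of $\mathcal{A}$ in the same number of ways. It is a simplicial $\mathcal{H}$-RDS if it is an $\mathcal{H}$-RDS that is also a set of representatives of the nonidentity cosets of $\mathcal{H}$ (exactly one element in each coset of $\mathcal{H}$ other than $\mathcal{H}$, and none in $\mathcal{H}$).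 A sequence of $N$ unit-norm vectors is an equiangular tight frame $\mathrm{ETF}(k,N)$ for a $k$-dimensional complex Hilbert space $\mathbb{H}$ if $C\|\mathbf{x}\|^2=\sum_n|\langle\boldsymbol{\varphi}_n,\mathbf{x}\rangle|^2$ for all $\mathbf{x}\in\mathbb{H}$, for some $C>0$, and $|\langle\boldsymbol{\varphi}_n,\boldsymbol{\varphi}_{n'}\rangle|$ is constant over $n\neq n'$. A regular $S$-simplex is an $\mathrm{ETF}(S,S+1)$. A circulant conference matrix here is a matrix $\mathbf{C}$ indexed by $(\mathcal{G}/\mathcal{H})\times(\mathcal{G}/\mathcal{H})$ (so of size $(S+1)\times(S+1)$), with entries depending only on $\overline{g}-\overline{g}'$, whose diagonal entries are zero, whose off-diagonal entries are unimodular, and with $\mathbf{C}^*\mathbf{C}=S\mathbf{I}$. A subset $\mathcal{D}$ of a finite abelian group is a difference set if every nonzero group element can be written as a difference of members of $\mathcal{D}$ in the same number of ways. A nonempty $D$-element difference set $\mathcal{D}$ for $\mathcal{G}$ is $\mathcal{H}$-fine if $\mathcal{D}\cap\mathcal{H}=\emptyset$ and $\mathcal{H}$ has order $\frac{G}{S+1}$ where $S=\left[\frac{D(G-1)}{G-D}\right]^{1/2}$. It is composite if it is $\mathcal{H}$-fine for some subgroup $\mathcal{H}$ and there exist an $S$-element subset $\mathcal{A}$ of $\mathcal{G}$ and a difference set $\mathcal{B}$ for $\mathcal{H}$ with $\chi_{\mathcal{D}}=\chi_{\mathcal{A}}*\chi_{\mathcal{B}}$. *)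

theory Defs
  imports Complex_Main "HOL-Algebra.Coset" "HOL-Library.Indicator_Function"
begin

text \<open>
  Groups are HOL-Algebra structures and hence written multiplicatively:
  \<open>\<one>\<close> is the zero of an additively written group, \<open>a \<otimes> inv b\<close> is the difference \<open>a - b\<close>, and
  \<open>H #> g\<close> is the coset \<open>g + H\<close>. The quotient group is \<open>G Mod H\<close>, with carrier \<open>rcosets H\<close>.
\<close>

subsection \<open>Characters and the Fourier transform\<close>

definition circle_group :: "complex monoid" where
  "circle_group = \<lparr>carrier = {z. cmod z = 1}, mult = (*), one = 1\<rparr>"

text \<open>Characters are extensional, so that each one is represented by exactly one function.\<close>

definition characters :: "('a, 'b) monoid_scheme \<Rightarrow> ('a \<Rightarrow> complex) set" where
  "characters G = hom G circle_group \<inter> extensional (carrier G)"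

definition dual_group :: "('a, 'b) monoid_scheme \<Rightarrow> ('a \<Rightarrow> complex) monoid" where
  "dual_group G =
     \<lparr>carrier = characters G,
      mult = (\<lambda>\<gamma> \<gamma>'. \<lambda>g\<in>carrier G. \<gamma> g * \<gamma>' g),
      one = (\<lambda>g\<in>carrier G. 1)\<rparr>"

definition annihilator :: "('a, 'b) monoid_scheme \<Rightarrow> 'a set \<Rightarrow> ('a \<Rightarrow> complex) set" where
  "annihilator G H = {\<gamma> \<in> carrier (dual_group G). \<forall>h\<in>H. \<gamma> h = 1}"

definition dual_coset ::
  "('a, 'b) monoid_scheme \<Rightarrow> 'a set \<Rightarrow> ('a \<Rightarrow> complex) \<Rightarrow> ('a \<Rightarrow> complex) set" where
  "dual_coset G H \<gamma> = \<gamma> <#\<^bsub>dual_group G\<^esub> annihilator G H"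

definition fourier_adj ::
  "('a, 'b) monoid_scheme \<Rightarrow> ('a \<Rightarrow> complex) \<Rightarrow> ('a \<Rightarrow> complex) \<Rightarrow> complex" where
  "fourier_adj G x \<gamma> = (\<Sum>g\<in>carrier G. cnj (\<gamma> g) * x g)"

definition convolution ::
  "('a, 'b) monoid_scheme \<Rightarrow> ('a \<Rightarrow> complex) \<Rightarrow> ('a \<Rightarrow> complex) \<Rightarrow> 'a \<Rightarrow> complex" where
  "convolution G x1 x2 g = (\<Sum>g'\<in>carrier G. x1 g' * x2 (g \<otimes>\<^bsub>G\<^esub> inv\<^bsub>G\<^esub> g'))"

subsection \<open>Difference sets\<close>

definition num_differences :: "('a, 'b) monoid_scheme \<Rightarrow> 'a set \<Rightarrow> 'a \<Rightarrow> nat" where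
  "num_differences G A g = card {(a, a'). a \<in> A \<and> a' \<in> A \<and> g = a \<otimes>\<^bsub>G\<^esub> inv\<^bsub>G\<^esub> a'}"

definition difference_set :: "('a, 'b) monoid_scheme \<Rightarrow> 'a set \<Rightarrow> bool" where
  "difference_set G D \<longleftrightarrow>
     D \<subseteq> carrier G \<and> (\<exists>\<Lambda>. \<forall>g\<in>carrier G - {\<one>\<^bsub>G\<^esub>}. num_differences G D g = \<Lambda>)"

definition relative_difference_set :: "('a, 'b) monoid_scheme \<Rightarrow> 'a set \<Rightarrow> 'a set \<Rightarrow> bool" where
  "relative_difference_set G H A \<longleftrightarrow>
     A \<subseteq> carrier G \<and>
     (\<forall>h\<in>H - {\<one>\<^bsub>G\<^esub>}. \<not> (\<exists>a\<in>A. \<exists>a'\<in>A. h = a \<otimes>\<^bsub>G\<^esub> inv\<^bsub>G\<^esub> a')) \<and>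
     (\<exists>\<Lambda>. \<forall>g\<in>carrier G - H. num_differences G A g = \<Lambda>)"

definition simplicial_RDS :: "('a, 'b) monoid_scheme \<Rightarrow> 'a set \<Rightarrow> 'a set \<Rightarrow> bool" where
  "simplicial_RDS G H A \<longleftrightarrow>
     relative_difference_set G H A \<and>
     A \<inter> H = {} \<and> (\<forall>K \<in> rcosets\<^bsub>G\<^esub> H - {H}. \<exists>!a. a \<in> A \<inter> K)"

definition fine_difference_set :: "('a, 'b) monoid_scheme \<Rightarrow> 'a set \<Rightarrow> 'a set \<Rightarrow> bool" where
  "fine_difference_set G H D \<longleftrightarrow>
     subgroup H G \<and> difference_set G D \<and> D \<noteq> {} \<and> D \<inter> H = {} \<and>
     (let S = sqrt (real (card D) * (real (order G) - 1) / (real (order G) - real (card D)))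
      in real (card H) = real (order G) / (S + 1))"

subsection \<open>Frames in \<open>\<complex>\<^sup>A\<close>\<close>

text \<open>A vector of \<open>\<complex>\<^sup>A\<close> is a complex function of which only the values on \<open>A\<close> are used.\<close>

definition inner_on :: "'a set \<Rightarrow> ('a \<Rightarrow> complex) \<Rightarrow> ('a \<Rightarrow> complex) \<Rightarrow> complex" where
  "inner_on A x y = (\<Sum>a\<in>A. cnj (x a) * y a)"

definition norm_on :: "'a set \<Rightarrow> ('a \<Rightarrow> complex) \<Rightarrow> real" where
  "norm_on A x = sqrt (Re (inner_on A x x))"

text \<open>The family \<open>\<phi>\<close>, indexed by the set \<open>I\<close>, is an \<open>ETF(k, N)\<close> for \<open>\<complex>\<^sup>A\<close>.\<close>

definition is_ETF ::
  "nat \<Rightarrow> nat \<Rightarrow> 'a set \<Rightarrow> 'i set \<Rightarrow> ('i \<Rightarrow> 'a \<Rightarrow> complex) \<Rightarrow> bool" where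
  "is_ETF k N A I \<phi> \<longleftrightarrow>
     finite A \<and> card A = k \<and> finite I \<and> card I = N \<and>
     (\<forall>n\<in>I. norm_on A (\<phi> n) = 1) \<and>
     (\<exists>C>0. \<forall>x. C * (norm_on A x)\<^sup>2 = (\<Sum>n\<in>I. (cmod (inner_on A (\<phi> n) x))\<^sup>2)) \<and>
     (\<exists>c. \<forall>n\<in>I. \<forall>n'\<in>I. n \<noteq> n' \<longrightarrow> cmod (inner_on A (\<phi> n) (\<phi> n')) = c)"

definition regular_simplex ::
  "nat \<Rightarrow> 'a set \<Rightarrow> 'i set \<Rightarrow> ('i \<Rightarrow> 'a \<Rightarrow> complex) \<Rightarrow> bool" where
  "regular_simplex S A I \<phi> \<longleftrightarrow> is_ETF S (S + 1) A I \<phi>"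

subsection \<open>Matrices indexed by a group\<close>

definition circulant_conference_matrix ::
  "('c, 'd) monoid_scheme \<Rightarrow> nat \<Rightarrow> ('c \<Rightarrow> 'c \<Rightarrow> complex) \<Rightarrow> bool" where
  "circulant_conference_matrix Q S M \<longleftrightarrow>
     order Q = S + 1 \<and>
     (\<exists>f. \<forall>x\<in>carrier Q. \<forall>y\<in>carrier Q. M x y = f (x \<otimes>\<^bsub>Q\<^esub> inv\<^bsub>Q\<^esub> y)) \<and>
     (\<forall>x\<in>carrier Q. M x x = 0) \<and>
     (\<forall>x\<in>carrier Q. \<forall>y\<in>carrier Q. x \<noteq> y \<longrightarrow> cmod (M x y) = 1) \<and>
     (\<forall>x\<in>carrier Q. \<forall>y\<in>carrier Q.
        (\<Sum>z\<in>carrier Q. cnj (M z x) * M z y) = (if x = y then of_nat S else 0))"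

definition C_hat ::
  "('a, 'b) monoid_scheme \<Rightarrow> 'a set \<Rightarrow> 'a set \<Rightarrow> ('a \<Rightarrow> complex) \<Rightarrow> 'a set \<Rightarrow> 'a set \<Rightarrow> complex" where
  "C_hat G H A \<gamma> X Y =
     (\<Sum>a\<in>{a \<in> A. H #>\<^bsub>G\<^esub> a = X \<otimes>\<^bsub>G Mod H\<^esub> inv\<^bsub>G Mod H\<^esub> Y}. \<gamma> a)"

definition C_mat ::
  "('a, 'b) monoid_scheme \<Rightarrow> 'a set \<Rightarrow> nat \<Rightarrow> 'a set \<Rightarrow> ('a \<Rightarrow> complex) \<Rightarrow> 'a set \<Rightarrow> 'a set \<Rightarrow> complex"
  where
  "C_mat G H S D \<gamma> X Y =
     of_real (real S powr (3 / 2) / real (card D)) *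
     (\<Sum>d\<in>{d \<in> D. H #>\<^bsub>G\<^esub> d = X \<otimes>\<^bsub>G Mod H\<^esub> inv\<^bsub>G Mod H\<^esub> Y}. \<gamma> d)"

end

theory Submission
  imports Defs "HOL-Algebra.Multiplicative_Group"
begin

text \<open>
  Everything is read off the number \<open>N(g)\<close> of representations of \<open>g\<close> as a difference of two members
  of \<open>A\<close>, whose Fourier transform is \<open>\<bar>\<Sum>a\<in>A. \<gamma> a\<bar>\<^sup>2\<close>. A simplicial RDS has
  \<open>N = S \<sqdot> \<delta> + \<Lambda> \<sqdot> (\<chi>\<^sub>G - \<chi>\<^sub>H)\<close> and meets every nonidentity coset of \<open>H\<close> once, which gives (ii);
  Fourier inversion recovers \<open>N\<close> from (ii). The inner products in (iii) are the character sums
  in (ii) divided by \<open>S\<close>. Conversely, tightness of the simplices, tested on the vectors \<open>\<delta>\<^sub>a\<close> and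
  \<open>\<delta>\<^sub>a + \<delta>\<^bsub>a'\<^esub>\<close>, together with their sum being zero, forces \<open>A\<close> to be a transversal of the
  nonidentity cosets, and Parseval's identity then determines the constant modulus. The Gram matrix
  of \<open>C_hat\<close> is a sum of \<open>N(g) \<gamma>(g)\<close> over a coset of \<open>H\<close>. In the composite case
  \<open>C_mat\<close> is \<open>C_hat\<close> times \<open>S\<^bsup>3/2\<^esup>/D \<sqdot> (\<Sum>b\<in>B. \<gamma> b)\<close>, whose modulus is 1 because \<open>B\<close> is a
  difference set of the size forced by fineness.
\<close>

subsection \<open>Characters of finite abelian groups\<close>

lemma hom_circle_iff:
  "\<gamma> \<in> hom G circle_group \<longleftrightarrow>
     (\<forall>x\<in>carrier G. cmod (\<gamma> x) = 1) \<and>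
     (\<forall>x\<in>carrier G. \<forall>y\<in>carrier G. \<gamma> (x \<otimes>\<^bsub>G\<^esub> y) = \<gamma> x * \<gamma> y)"
  by (auto simp: hom_def circle_group_def)

lemma cnj_eq_inverse: "cmod z = 1 \<Longrightarrow> cnj z = inverse z"
  by (metis complex_norm_square inverse_unique mult.commute of_real_1 one_power2 power2_eq_square)

lemma complex_unit_root:
  assumes "cmod w = 1" "n > 0"
  obtains z where "cmod z = 1" "z ^ n = w"
proof
  show "cmod (cis (Arg w / real n)) = 1" by simp
  have "w \<noteq> 0" using assms by auto
  thus "cis (Arg w / real n) ^ n = w"
    using assms by (simp add: DeMoivre cis_Arg sgn_eq)
qed

section \<open>Homomorphisms into the circle group\<close>

context group
begin

lemma hom_circle_norm: "\<gamma> \<in> hom G circle_group \<Longrightarrow> x \<in> carrier G \<Longrightarrow> cmod (\<gamma> x) = 1"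
  and hom_circle_mult:
    "\<gamma> \<in> hom G circle_group \<Longrightarrow> x \<in> carrier G \<Longrightarrow> y \<in> carrier G \<Longrightarrow> \<gamma> (x \<otimes> y) = \<gamma> x * \<gamma> y"
  by (simp_all add: hom_circle_iff)

lemma hom_circle_one:
  assumes "\<gamma> \<in> hom G circle_group" shows "\<gamma> \<one> = 1"
proof -
  have "\<gamma> \<one> * \<gamma> \<one> = \<gamma> \<one>" using hom_circle_mult[OF assms, of \<one> \<one>] by simp
  moreover have "\<gamma> \<one> \<noteq> 0" using hom_circle_norm[OF assms, of \<one>] by auto
  ultimately show ?thesis by simp
qed

lemma hom_circle_inv_inverse:
  assumes "\<gamma> \<in> hom G circle_group" "x \<in> carrier G" shows "\<gamma> (inv x) = inverse (\<gamma> x)"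
  using hom_circle_mult[OF assms(1), of x "inv x"] hom_circle_one[OF assms(1)] assms(2)
  by (simp add: inverse_unique)

lemma hom_circle_inv:
  assumes "\<gamma> \<in> hom G circle_group" "x \<in> carrier G" shows "\<gamma> (inv x) = cnj (\<gamma> x)"
  using assms by (simp add: hom_circle_inv_inverse cnj_eq_inverse hom_circle_norm)

lemma hom_circle_cnj_mult:
  assumes "\<gamma> \<in> hom G circle_group" "x \<in> carrier G" shows "cnj (\<gamma> x) * \<gamma> x = 1"
  using hom_circle_norm[OF assms]
  by (metis complex_norm_square mult.commute of_real_1 one_power2)

lemma hom_circle_diff:
  assumes "\<gamma> \<in> hom G circle_group" "x \<in> carrier G" "y \<in> carrier G"
  shows "\<gamma> (x \<otimes> inv y) = \<gamma> x * cnj (\<gamma> y)"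
  using assms by (simp add: hom_circle_mult hom_circle_inv)

lemma hom_circle_nat_pow:
  assumes "\<gamma> \<in> hom G circle_group" "x \<in> carrier G"
  shows "\<gamma> (x [^] (n::nat)) = \<gamma> x ^ n"
  using assms by (induction n) (simp_all add: hom_circle_one hom_circle_mult)

lemma hom_circle_int_pow:
  assumes "\<gamma> \<in> hom G circle_group" "x \<in> carrier G"
  shows "\<gamma> (x [^] (m::int)) = \<gamma> x powi m"
  using assms
  by (cases m rule: int_cases2)
     (simp_all add: int_pow_int int_pow_neg_int hom_circle_nat_pow hom_circle_inv_inverse
        power_int_minus)

text \<open>The exponents that send \<open>x\<close> into \<open>K\<close> form a subgroup of the
  integers, nonzero because \<open>G\<close> is finite. Its least positive member \<open>n\<close>,
  the order of \<open>x\<close> modulo \<open>K\<close>, generates it.\<close>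

lemma int_pow_mem_subgroup_iff:
  assumes "finite (carrier G)" "subgroup K G" "x \<in> carrier G"
  obtains n :: nat where "n > 0" "\<And>j::int. x [^] j \<in> K \<longleftrightarrow> int n dvd j"
proof -
  \<comment> \<open>The exponent \<open>order G\<close> shows that some positive power of
    \<open>x\<close> lies in \<open>K\<close>, so the \<open>LEAST\<close> below is
    attained.\<close>
  have fin: "x [^] order G \<in> K" "order G > 0"
    using pow_order_eq_1[OF assms(3)] subgroup.one_closed[OF assms(2)] assms(1)
    by (auto simp: order_gt_0_iff_finite)
  define n where "n = (LEAST n::nat. n > 0 \<and> x [^] n \<in> K)"
  have n: "n > 0 \<and> x [^] n \<in> K"
    unfolding n_def using LeastI_ex[of "\<lambda>n::nat. n > 0 \<and> x [^] n \<in> K"] fin by blast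
  have least: "n \<le> m" if "m > 0" "x [^] m \<in> K" for m :: nat
    unfolding n_def by (rule Least_le) (use that in auto)
  have mult: "x [^] (int n * q) \<in> K" for q :: int
    using n int_pow_pow[OF assms(3), of "int n" q] assms(3)
      subgroup_int_pow_closed[OF assms(2), of "x [^] n" q]
    by (simp add: int_pow_int)
  have "int n dvd j" if "x [^] j \<in> K" for j
  proof -
    \<comment> \<open>Division with remainder: the remainder also sends \<open>x\<close> into
      \<open>K\<close> and is below \<open>n\<close>, so minimality makes it zero.\<close>
    have "j mod int n = j - int n * (j div int n)" by (simp add: minus_mult_div_eq_mod)
    hence "x [^] (j mod int n) \<in> K"
      using that mult[of "j div int n"] assms(2,3)
      by (simp add: int_pow_diff subgroup.m_closed subgroup.m_inv_closed)
    moreover have "j mod int n = int (nat (j mod int n))" using n by simp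
    ultimately have "x [^] nat (j mod int n) \<in> K" by (metis int_pow_int)
    with least[of "nat (j mod int n)"] have "nat (j mod int n) = 0 \<or> n \<le> nat (j mod int n)" by blast
    moreover have "j mod int n < int n" "j mod int n \<ge> 0" using n by auto
    ultimately have "j mod int n = 0" by linarith
    thus ?thesis by auto
  qed
  moreover have "x [^] j \<in> K" if "int n dvd j" for j using that mult by auto
  ultimately show thesis using that n by blast
qed

end

section \<open>Extension of characters from subgroups\<close>

context comm_group
begin

text \<open>The extension to the subgroup generated by \<open>K\<close> and \<open>x\<close> sends
  \<open>k \<otimes> x [^] j\<close> to \<open>\<chi> k * z powi j\<close>. The powers of
  \<open>x\<close> inside \<open>K\<close> are those of \<open>x [^] n\<close>, so only the
  \<open>n\<close>-th power of \<open>z\<close> is prescribed; the remaining freedom in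
  \<open>z\<close> is what later separates points from subgroups.\<close>

lemma hom_circle_extend_step:
  assumes K: "subgroup K G" and \<chi>: "\<chi> \<in> hom (G\<lparr>carrier := K\<rparr>) circle_group"
    and x: "x \<in> carrier G" and n: "\<And>j::int. x [^] j \<in> K \<longleftrightarrow> int n dvd j"
    and z: "cmod z = 1" "z ^ n = \<chi> (x [^] n)"
  obtains L \<psi> where "subgroup L G" "K \<subseteq> L" "x \<in> L" "\<psi> \<in> hom (G\<lparr>carrier := L\<rparr>) circle_group"
    "\<And>k. k \<in> K \<Longrightarrow> \<psi> k = \<chi> k" "\<psi> x = z"
proof -
  interpret K: group "G\<lparr>carrier := K\<rparr>" using subgroup_imp_group[OF K] .
  have KG: "k \<in> carrier G" if "k \<in> K" for k using subgroup.mem_carrier[OF K that] .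
  have z0: "z \<noteq> 0" using z(1) by auto
  have \<chi>m: "\<chi> (k \<otimes> l) = \<chi> k * \<chi> l" if "k \<in> K" "l \<in> K" for k l
    using K.hom_circle_mult[OF \<chi>, of k l] that by simp
  have \<chi>pow: "\<chi> (x [^] j) = z powi j" if "x [^] j \<in> K" for j :: int
  proof -
    have "int n dvd j" using that n by simp
    then obtain q where q: "j = int n * q" by (elim dvdE)
    have xn: "x [^] n \<in> K" using n[of "int n"] by (simp add: int_pow_int)
    have "x [^] j = (x [^] n) [^] q" using q x by (simp add: int_pow_pow int_pow_int[symmetric])
    hence "\<chi> (x [^] j) = \<chi> (x [^] n) powi q"
      using K.hom_circle_int_pow[OF \<chi>, of "x [^] n" q] xn int_pow_consistent[OF K xn] by simp
    thus ?thesis using q z(2) by (simp add: power_int_mult)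
  qed
  define L where "L = (\<lambda>(k, j). k \<otimes> x [^] (j::int)) ` (K \<times> UNIV)"
  \<comment> \<open>Two representations of one element differ by a power of \<open>x\<close> that
    lies in \<open>K\<close>, and there \<open>\<chi>pow\<close> gives the value.\<close>
  have wd: "\<chi> k * z powi i = \<chi> l * z powi j"
    if "k \<in> K" "l \<in> K" "k \<otimes> x [^] i = l \<otimes> x [^] j" for k l and i j :: int
  proof -
    have "k = l \<otimes> x [^] j \<otimes> inv (x [^] i)"
      using that(3) that(1,2)[THEN KG] x by (metis int_pow_closed inv_solve_right m_closed)
    hence kl: "k = l \<otimes> x [^] (j - i)"
      using that(1,2)[THEN KG] x by (simp add: int_pow_diff m_assoc)
    hence "x [^] (j - i) = inv l \<otimes> k"
      using that(1,2)[THEN KG] x by (simp add: inv_solve_left)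
    hence "x [^] (j - i) \<in> K" using that K by (simp add: subgroup.m_closed subgroup.m_inv_closed)
    hence "\<chi> k = \<chi> l * z powi (j - i)" using kl \<chi>m that \<chi>pow by simp
    thus ?thesis using z0 by (simp add: power_int_diff)
  qed
  \<comment> \<open>\<open>SOME\<close> picks an arbitrary representation of \<open>y\<close>; by
    \<open>wd\<close> the value does not depend on the choice.\<close>
  define \<psi> where "\<psi> y = (case SOME (k, j). k \<in> K \<and> y = k \<otimes> x [^] (j::int) of (k, j) \<Rightarrow> \<chi> k * z powi j)" for y
  have \<psi>: "\<psi> (k \<otimes> x [^] j) = \<chi> k * z powi j" if "k \<in> K" for k and j :: int
  proof -
    let ?P = "\<lambda>p. case p of (l, i) \<Rightarrow> l \<in> K \<and> k \<otimes> x [^] j = l \<otimes> x [^] (i::int)"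
    obtain l i where li: "(SOME p. ?P p) = (l, i)" by fastforce
    have "?P (l, i)" unfolding li[symmetric] by (rule someI[of ?P "(k, j)"]) (use that in simp)
    hence "\<chi> k * z powi j = \<chi> l * z powi i" using wd that by auto
    thus ?thesis by (simp add: \<psi>_def li)
  qed
  have mult: "(k \<otimes> x [^] i) \<otimes> (l \<otimes> x [^] j) = (k \<otimes> l) \<otimes> x [^] (i + j)"
    if "k \<in> K" "l \<in> K" for k l and i j :: int
    using that[THEN KG] x by (simp add: int_pow_mult m_ac)
  have LI: "k \<otimes> x [^] j \<in> L" if "k \<in> K" for k and j :: int using that unfolding L_def by auto
  have LE: thesis if "y \<in> L" "\<And>k j. k \<in> K \<Longrightarrow> y = k \<otimes> x [^] (j::int) \<Longrightarrow> thesis" for y thesis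
    using that unfolding L_def by auto
  have oneK: "\<one> \<in> K" using subgroup.one_closed[OF K] .
  have sub: "subgroup L G"
  proof
    show "L \<subseteq> carrier G" unfolding L_def using KG x by auto
    show "y \<otimes> w \<in> L" if yw: "y \<in> L" "w \<in> L" for y w
    proof -
      obtain k i where k: "k \<in> K" "y = k \<otimes> x [^] (i::int)" using yw(1) by (elim LE)
      obtain l j where l: "l \<in> K" "w = l \<otimes> x [^] (j::int)" using yw(2) by (elim LE)
      show ?thesis
        unfolding k(2) l(2) mult[OF k(1) l(1)] by (rule LI[OF subgroup.m_closed[OF K k(1) l(1)]])
    qed
    show "\<one> \<in> L" using LI[OF oneK, of 0] by simp
    show "inv y \<in> L" if y: "y \<in> L" for y
    proof -
      obtain k i where ki: "k \<in> K" "y = k \<otimes> x [^] (i::int)" using y by (elim LE)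
      hence "inv y = inv k \<otimes> x [^] (- i)" using KG x by (simp add: inv_mult int_pow_neg)
      thus ?thesis using LI ki subgroup.m_inv_closed[OF K] by simp
    qed
  qed
  have KL: "K \<subseteq> L"
  proof
    fix k assume "k \<in> K" thus "k \<in> L" using LI[of k 0] KG by simp
  qed
  have hom: "\<psi> \<in> hom (G\<lparr>carrier := L\<rparr>) circle_group"
    unfolding hom_circle_iff
  proof (intro conjI ballI)
    fix y assume "y \<in> carrier (G\<lparr>carrier := L\<rparr>)"
    hence "y \<in> L" by simp
    then obtain k i where k: "k \<in> K" "y = k \<otimes> x [^] (i::int)" by (elim LE)
    have "cmod (\<chi> k) = 1" using K.hom_circle_norm[OF \<chi>, of k] k(1) by simp
    thus "cmod (\<psi> y) = 1"
      unfolding k(2) \<psi>[OF k(1)] by (simp add: norm_mult norm_power_int z(1))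
  next
    fix y w assume "y \<in> carrier (G\<lparr>carrier := L\<rparr>)" "w \<in> carrier (G\<lparr>carrier := L\<rparr>)"
    hence yw: "y \<in> L" "w \<in> L" by simp_all
    obtain k i where k: "k \<in> K" "y = k \<otimes> x [^] (i::int)" using yw(1) by (elim LE)
    obtain l j where l: "l \<in> K" "w = l \<otimes> x [^] (j::int)" using yw(2) by (elim LE)
    have "y \<otimes> w = (k \<otimes> l) \<otimes> x [^] (i + j)" unfolding k(2) l(2) by (rule mult[OF k(1) l(1)])
    hence "\<psi> (y \<otimes> w) = \<chi> (k \<otimes> l) * z powi (i + j)"
      using \<psi>[OF subgroup.m_closed[OF K k(1) l(1)]] by simp
    also have "\<dots> = \<psi> y * \<psi> w"
      unfolding k(2) l(2) \<psi>[OF k(1)] \<psi>[OF l(1)] \<chi>m[OF k(1) l(1)]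
      using z0 by (simp add: power_int_add)
    finally show "\<psi> (y \<otimes>\<^bsub>G\<lparr>carrier := L\<rparr>\<^esub> w) = \<psi> y * \<psi> w" by simp
  qed
  have "\<psi> k = \<chi> k" if "k \<in> K" for k using \<psi>[OF that, of 0] KG[OF that] by simp
  moreover have "\<psi> x = z" "x \<in> L"
    using \<psi>[OF oneK, of 1] LI[OF oneK, of 1] x K.hom_circle_one[OF \<chi>] by simp_all
  ultimately show thesis using that sub KL hom by blast
qed

text \<open>Induction on the number of elements outside \<open>K\<close>: some \<open>x\<close>
  outside \<open>K\<close> is adjoined, with any \<open>n\<close>-th root of the value of
  \<open>\<chi>\<close> at \<open>x [^] n\<close> as its image.\<close>

lemma hom_circle_extend:
  assumes fin: "finite (carrier G)"
  shows "subgroup K G \<Longrightarrow> \<chi> \<in> hom (G\<lparr>carrier := K\<rparr>) circle_group \<Longrightarrow>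
    \<exists>\<psi>\<in>hom G circle_group. \<forall>k\<in>K. \<psi> k = \<chi> k"
proof (induction "card (carrier G - K)" arbitrary: K \<chi> rule: less_induct)
  case less
  note K = \<open>subgroup K G\<close>
  interpret K: group "G\<lparr>carrier := K\<rparr>" using subgroup_imp_group[OF K] .
  show ?case
  proof (cases "K = carrier G")
    case True thus ?thesis using less.prems by auto
  next
    case False
    then obtain x where x: "x \<in> carrier G" "x \<notin> K" using subgroup.subset[OF K] by auto
    obtain n :: nat where n: "n > 0" "\<And>j::int. x [^] j \<in> K \<longleftrightarrow> int n dvd j"
      using int_pow_mem_subgroup_iff[OF fin K x(1)] by metis
    have "x [^] n \<in> K" using n(2)[of "int n"] by (simp add: int_pow_int)
    hence "cmod (\<chi> (x [^] n)) = 1" using K.hom_circle_norm[OF less.prems(2)] by simp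
    then obtain z where z: "cmod z = 1" "z ^ n = \<chi> (x [^] n)" using complex_unit_root n(1) by metis
    obtain L \<psi> where L: "subgroup L G" "K \<subseteq> L" "x \<in> L"
      "\<psi> \<in> hom (G\<lparr>carrier := L\<rparr>) circle_group" "\<And>k. k \<in> K \<Longrightarrow> \<psi> k = \<chi> k"
      using hom_circle_extend_step[OF K less.prems(2) x(1) n(2) z] by metis
    have "card (carrier G - L) < card (carrier G - K)"
      by (rule psubset_card_mono) (use fin L x in auto)
    from less.hyps[OF this L(1,4)] L(2,5) show ?thesis by (metis subsetD)
  qed
qed

lemma hom_circle_separates:
  assumes fin: "finite (carrier G)" and H: "subgroup H G" and x: "x \<in> carrier G" "x \<notin> H"
  obtains \<gamma> where "\<gamma> \<in> hom G circle_group" "\<And>h. h \<in> H \<Longrightarrow> \<gamma> h = 1" "\<gamma> x \<noteq> 1"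
proof -
  txt \<open>The trivial character of \<open>H\<close> extends to \<open>\<langle>H, x\<rangle>\<close> with a primitive \<open>n\<close>-th root of unity at \<open>x\<close>,
    where \<open>n > 1\<close> is the order of \<open>x\<close> modulo \<open>H\<close>.\<close>
  obtain n :: nat where n: "n > 0" "\<And>j::int. x [^] j \<in> H \<longleftrightarrow> int n dvd j"
    using int_pow_mem_subgroup_iff[OF fin H x(1)] by metis
  have "n \<noteq> 1" using n(2)[of 1] x by auto
  hence n2: "n > 1" using n(1) by simp
  define z where "z = cis (2 * pi / real n)"
  have z: "cmod z = 1" "z ^ n = 1" using n2 by (simp_all add: z_def DeMoivre)
  have z1: "z \<noteq> 1"
  proof
    assume "z = 1"
    \<comment> \<open>The numbers \<open>cis (2 * pi * k / n)\<close> with \<open>k < n\<close> are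
      distinct; \<open>k = 1\<close> and \<open>k = 0\<close> are compared.\<close>
    hence "cis (2 * pi * real 1 / real n) = cis (2 * pi * real 0 / real n)" by (simp add: z_def)
    thus False using bij_betw_roots_unity[OF n(1)] n2
      unfolding bij_betw_def inj_on_def by (metis lessThan_iff n(1) zero_neq_one)
  qed
  have triv: "(\<lambda>_. 1) \<in> hom (G\<lparr>carrier := H\<rparr>) circle_group" by (simp add: hom_circle_iff)
  obtain L \<psi> where L: "subgroup L G" "H \<subseteq> L" "x \<in> L"
    "\<psi> \<in> hom (G\<lparr>carrier := L\<rparr>) circle_group" "\<And>k. k \<in> H \<Longrightarrow> \<psi> k = 1" "\<psi> x = z"
    using hom_circle_extend_step[OF H triv x(1) n(2) z] by metis
  obtain \<gamma> where "\<gamma> \<in> hom G circle_group" "\<forall>k\<in>L. \<gamma> k = \<psi> k"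
    using hom_circle_extend[OF fin L(1,4)] by blast
  thus thesis using that L z1 by (metis subsetD)
qed

end

text \<open>Serves a quadratic form with no terms off the diagonal; \<open>P\<close> is then
  membership of a difference in the subgroup.\<close>

lemma sum_sum_diagonal:
  assumes "finite A" "\<And>a a'. a \<in> A \<Longrightarrow> a' \<in> A \<Longrightarrow> P a a' \<longleftrightarrow> a = a'"
  shows "(\<Sum>a\<in>A. \<Sum>a'\<in>A. if P a a' then f a a' else 0) = (\<Sum>a\<in>A. f a a :: complex)"
proof (rule sum.cong[OF refl])
  fix a assume a: "a \<in> A"
  have "(\<Sum>a'\<in>A. if P a a' then f a a' else 0) = (\<Sum>a'\<in>A. if a = a' then f a a' else 0)"
    using assms(2)[OF a] by (intro sum.cong) auto
  thus "(\<Sum>a'\<in>A. if P a a' then f a a' else 0) = f a a" using a assms(1) by simp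
qed

section \<open>Orthogonality of characters and Fourier inversion\<close>

locale finite_comm_group = comm_group G for G (structure) +
  assumes finite_carrier [simp]: "finite (carrier G)"
begin

text \<open>Translation by \<open>x\<close> permutes the group and multiplies the sum by
  \<open>\<gamma> x\<close>, which differs from 1.\<close>

lemma sum_hom_circle_eq_0:
  assumes \<gamma>: "\<gamma> \<in> hom G circle_group" and x: "x \<in> carrier G" "\<gamma> x \<noteq> 1"
  shows "(\<Sum>g\<in>carrier G. \<gamma> g) = 0"
proof -
  have "(\<Sum>g\<in>carrier G. \<gamma> g) = (\<Sum>g\<in>carrier G. \<gamma> (x \<otimes> g))"
    by (rule sum.reindex_bij_witness[of _ "\<lambda>g. x \<otimes> g" "\<lambda>g. inv x \<otimes> g"])
       (use x in \<open>auto simp: m_assoc[symmetric]\<close>)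
  also have "\<dots> = \<gamma> x * (\<Sum>g\<in>carrier G. \<gamma> g)"
    using hom_circle_mult[OF \<gamma>] x by (simp add: sum_distrib_left)
  finally show ?thesis using x(2) by simp
qed

lemma carrier_dual_group [simp]: "carrier (dual_group G) = characters G"
  by (simp add: dual_group_def)

lemma characters_hom: "\<gamma> \<in> characters G \<Longrightarrow> \<gamma> \<in> hom G circle_group"
  by (simp add: characters_def)

lemma characters_mult:
  assumes "\<gamma> \<in> hom G circle_group" "\<gamma>' \<in> hom G circle_group"
  shows "(\<lambda>g\<in>carrier G. \<gamma> g * \<gamma>' g) \<in> characters G"
  using assms by (auto simp: characters_def hom_circle_iff norm_mult)

lemma characters_diff:
  assumes "\<gamma> \<in> hom G circle_group" "\<gamma>' \<in> hom G circle_group"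
  shows "(\<lambda>g\<in>carrier G. cnj (\<gamma> g) * \<gamma>' g) \<in> characters G"
  using assms by (auto simp: characters_def hom_circle_iff norm_mult)

lemma characters_one: "(\<lambda>g\<in>carrier G. 1) \<in> characters G"
  by (auto simp: characters_def hom_circle_iff)

text \<open>Character values are roots of unity of exponent \<open>order G\<close>, and there are
  finitely many extensional functions into that finite set.\<close>

lemma finite_characters: "finite (characters G)"
proof (rule finite_subset)
  have "\<gamma> x ^ order G = 1" if "\<gamma> \<in> characters G" "x \<in> carrier G" for \<gamma> x
    using hom_circle_nat_pow[OF characters_hom[OF that(1)] that(2), of "order G"]
      pow_order_eq_1[OF that(2)] hom_circle_one[OF characters_hom[OF that(1)]] by simp
  thus "characters G \<subseteq> (carrier G \<rightarrow>\<^sub>E {z. z ^ order G = 1})"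
    by (auto simp: characters_def extensional_def)
  show "finite (carrier G \<rightarrow>\<^sub>E {z::complex. z ^ order G = 1})"
    by (intro finite_PiE finite_carrier finite_roots_unity)
       (simp add: Suc_le_eq order_gt_0_iff_finite)
qed

lemma annihilator_iff: "\<gamma> \<in> annihilator G H \<longleftrightarrow> \<gamma> \<in> characters G \<and> (\<forall>h\<in>H. \<gamma> h = 1)"
  by (simp add: annihilator_def)

lemma finite_annihilator: "finite (annihilator G H)"
  by (rule finite_subset[OF _ finite_characters]) (auto simp: annihilator_iff)

lemma annihilator_one: "annihilator G {\<one>} = characters G"
  by (auto simp: annihilator_iff hom_circle_one characters_hom)

text \<open>If \<open>x\<close> is outside \<open>H\<close>, some \<open>\<chi>\<close> trivial on
  \<open>H\<close> has \<open>\<chi> x\<close> different from 1. Multiplication by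
  \<open>\<chi>\<close> permutes the annihilator and scales the sum by \<open>\<chi> x\<close>, so
  the sum vanishes.\<close>

lemma sum_annihilator:
  assumes H: "subgroup H G" and x: "x \<in> carrier G"
  shows "(\<Sum>\<gamma>\<in>annihilator G H. \<gamma> x) = (if x \<in> H then of_nat (card (annihilator G H)) else 0)"
proof (cases "x \<in> H")
  case True
  thus ?thesis by (simp add: annihilator_iff)
next
  case False
  obtain \<chi> where \<chi>: "\<chi> \<in> hom G circle_group" "\<And>h. h \<in> H \<Longrightarrow> \<chi> h = 1" "\<chi> x \<noteq> 1"
    using hom_circle_separates[OF finite_carrier H x False] by metis
  note HG = subgroup.mem_carrier[OF H]
  have unit': "cnj (\<chi> g) * (\<chi> g * c) = c" "\<chi> g * (cnj (\<chi> g) * c) = c"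
    if "g \<in> carrier G" for g c
    using hom_circle_cnj_mult[OF \<chi>(1) that] by (simp_all add: mult.assoc[symmetric] mult.commute[of "\<chi> g"])
  have "(\<Sum>\<gamma>\<in>annihilator G H. \<gamma> x) = (\<Sum>\<gamma>\<in>annihilator G H. \<chi> x * \<gamma> x)"
  proof (rule sum.reindex_bij_witness[of _ "\<lambda>\<gamma>. \<lambda>g\<in>carrier G. \<chi> g * \<gamma> g"
        "\<lambda>\<gamma>. \<lambda>g\<in>carrier G. cnj (\<chi> g) * \<gamma> g"])
    fix \<gamma> assume "\<gamma> \<in> annihilator G H"
    hence \<gamma>: "\<gamma> \<in> characters G" "\<And>h. h \<in> H \<Longrightarrow> \<gamma> h = 1" by (auto simp: annihilator_iff)
    have ext: "\<gamma> g = undefined" if "g \<notin> carrier G" for g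
      using \<gamma>(1) that by (auto simp: characters_def extensional_def)
    show "(\<lambda>g\<in>carrier G. cnj (\<chi> g) * \<gamma> g) \<in> annihilator G H"
      "(\<lambda>g\<in>carrier G. \<chi> g * \<gamma> g) \<in> annihilator G H"
      using characters_diff[OF \<chi>(1) characters_hom[OF \<gamma>(1)]]
        characters_mult[OF \<chi>(1) characters_hom[OF \<gamma>(1)]] \<chi>(2) \<gamma>(2) HG
      by (auto simp: annihilator_iff)
    show "(\<lambda>g\<in>carrier G. \<chi> g * (\<lambda>g\<in>carrier G. cnj (\<chi> g) * \<gamma> g) g) = \<gamma>"
      "(\<lambda>g\<in>carrier G. cnj (\<chi> g) * (\<lambda>g\<in>carrier G. \<chi> g * \<gamma> g) g) = \<gamma>"
      by (auto simp: fun_eq_iff restrict_def unit' ext)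
    show "\<chi> x * (\<lambda>g\<in>carrier G. cnj (\<chi> g) * \<gamma> g) x = \<gamma> x"
      using x by (simp add: unit')
  qed
  also have "\<dots> = \<chi> x * (\<Sum>\<gamma>\<in>annihilator G H. \<gamma> x)" by (simp add: sum_distrib_left)
  finally have "(\<Sum>\<gamma>\<in>annihilator G H. \<gamma> x) = 0" using \<chi>(3) by simp
  thus ?thesis using False by simp
qed

lemma sum_character:
  assumes "\<gamma> \<in> characters G"
  shows "(\<Sum>g\<in>carrier G. \<gamma> g) = (if \<gamma> = (\<lambda>g\<in>carrier G. 1) then of_nat (order G) else 0)"
proof (cases "\<gamma> = (\<lambda>g\<in>carrier G. 1)")
  case True
  thus ?thesis by (simp add: order_def)
next
  case False
  then obtain x where "x \<in> carrier G" "\<gamma> x \<noteq> 1"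
    using assms by (auto simp: fun_eq_iff characters_def extensional_def restrict_def split: if_splits)
  thus ?thesis using sum_hom_circle_eq_0[OF characters_hom[OF assms]] False by simp
qed

text \<open>Double counting of the sum of all \<open>\<gamma> g\<close>: summing over
  \<open>\<gamma>\<close> first leaves only \<open>g\<close> in \<open>H\<close>, summing over
  \<open>g\<close> first leaves only the trivial character.\<close>

lemma card_annihilator:
  assumes H: "subgroup H G"
  shows "card (annihilator G H) * card H = order G"
proof -
  have one: "(\<lambda>g\<in>carrier G. 1) \<in> annihilator G H"
    using characters_one subgroup.mem_carrier[OF H] by (auto simp: annihilator_iff)
  have "(of_nat (card (annihilator G H) * card H) :: complex) =
      (\<Sum>g\<in>carrier G. if g \<in> H then of_nat (card (annihilator G H)) else 0)"
    using subgroup.subset[OF H] by (simp add: sum.If_cases Int_absorb1)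
  also have "\<dots> = (\<Sum>g\<in>carrier G. \<Sum>\<gamma>\<in>annihilator G H. \<gamma> g)"
    by (intro sum.cong refl) (simp add: sum_annihilator[OF H])
  also have "\<dots> = (\<Sum>\<gamma>\<in>annihilator G H. \<Sum>g\<in>carrier G. \<gamma> g)" by (rule sum.swap)
  also have "\<dots> = (\<Sum>\<gamma>\<in>annihilator G H. if \<gamma> = (\<lambda>g\<in>carrier G. 1) then of_nat (order G) else 0)"
    by (intro sum.cong refl sum_character) (simp add: annihilator_iff)
  also have "\<dots> = of_nat (order G)"
    using one by (simp add: finite_annihilator)
  finally show ?thesis using of_nat_eq_iff by blast
qed

lemma sum_characters:
  assumes "x \<in> carrier G"
  shows "(\<Sum>\<gamma>\<in>characters G. \<gamma> x) = (if x = \<one> then of_nat (order G) else 0)"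
  using sum_annihilator[OF triv_subgroup assms] card_annihilator[OF triv_subgroup]
  by (simp add: annihilator_one)

text \<open>After the sums are swapped, each \<open>g\<close> carries the sum of all characters at
  \<open>g \<otimes> inv x\<close>, which vanishes unless \<open>g = x\<close>.\<close>

lemma fourier_inversion:
  assumes x: "x \<in> carrier G"
  shows "(\<Sum>\<gamma>\<in>characters G. cnj (\<gamma> x) * (\<Sum>g\<in>carrier G. \<gamma> g * u g)) = of_nat (order G) * u x"
proof -
  have "(\<Sum>\<gamma>\<in>characters G. cnj (\<gamma> x) * (\<Sum>g\<in>carrier G. \<gamma> g * u g)) =
      (\<Sum>\<gamma>\<in>characters G. \<Sum>g\<in>carrier G. \<gamma> (g \<otimes> inv x) * u g)"
    unfolding sum_distrib_left
    by (intro sum.cong refl) (simp add: hom_circle_diff characters_hom x mult_ac)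
  also have "\<dots> = (\<Sum>g\<in>carrier G. (\<Sum>\<gamma>\<in>characters G. \<gamma> (g \<otimes> inv x)) * u g)"
    by (subst sum.swap) (simp add: sum_distrib_right)
  also have "\<dots> = (\<Sum>g\<in>carrier G. if g = x then of_nat (order G) * u g else 0)"
    using x by (intro sum.cong refl) (simp add: sum_characters right_cancel[of "inv x" _ x, symmetric] del: right_cancel)
  also have "\<dots> = of_nat (order G) * u x" using x by simp
  finally show ?thesis .
qed

section \<open>Cosets of the annihilator\<close>

lemma dual_coset_image:
  "dual_coset G H \<gamma> = (\<lambda>\<eta>. \<lambda>g\<in>carrier G. \<gamma> g * \<eta> g) ` annihilator G H"
  by (auto simp: dual_coset_def l_coset_def dual_group_def)

text \<open>The quotient \<open>cnj (\<gamma> g) * \<gamma>' g\<close> is trivial on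
  \<open>H\<close> exactly when both characters agree there. Later questions about cosets of the
  annihilator thus become questions about restrictions to \<open>H\<close>.\<close>

lemma dual_coset_eq:
  assumes H: "subgroup H G" and \<gamma>: "\<gamma> \<in> characters G"
  shows "dual_coset G H \<gamma> = {\<gamma>' \<in> characters G. \<forall>h\<in>H. \<gamma>' h = \<gamma> h}"
proof (intro equalityI subsetI)
  fix \<gamma>' assume "\<gamma>' \<in> dual_coset G H \<gamma>"
  thus "\<gamma>' \<in> {\<gamma>' \<in> characters G. \<forall>h\<in>H. \<gamma>' h = \<gamma> h}"
    using subgroup.mem_carrier[OF H] \<gamma>
    by (auto simp: dual_coset_image annihilator_iff intro!: characters_mult characters_hom)
next
  fix \<gamma>' assume "\<gamma>' \<in> {\<gamma>' \<in> characters G. \<forall>h\<in>H. \<gamma>' h = \<gamma> h}"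
  hence \<gamma>': "\<gamma>' \<in> characters G" "\<And>h. h \<in> H \<Longrightarrow> \<gamma>' h = \<gamma> h" by auto
  define \<eta> where "\<eta> = (\<lambda>g\<in>carrier G. cnj (\<gamma> g) * \<gamma>' g)"
  have "\<eta> \<in> annihilator G H"
    using characters_diff[OF characters_hom[OF \<gamma>] characters_hom[OF \<gamma>'(1)]]
      subgroup.mem_carrier[OF H] \<gamma>'(2) hom_circle_cnj_mult[OF characters_hom[OF \<gamma>]]
    by (auto simp: annihilator_iff \<eta>_def)
  moreover have "(\<lambda>g\<in>carrier G. \<gamma> g * \<eta> g) = \<gamma>'"
  proof
    fix g show "(\<lambda>g\<in>carrier G. \<gamma> g * \<eta> g) g = \<gamma>' g"
      using hom_circle_cnj_mult[OF characters_hom[OF \<gamma>], of g] \<gamma>'(1)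
      by (auto simp: \<eta>_def restrict_def characters_def extensional_def mult.assoc[symmetric]
          mult.commute[of "\<gamma> g"])
  qed
  ultimately show "\<gamma>' \<in> dual_coset G H \<gamma>" unfolding dual_coset_image by force
qed

lemma dual_coset_eq_iff:
  assumes "subgroup H G" "\<gamma> \<in> characters G" "\<gamma>' \<in> characters G"
  shows "dual_coset G H \<gamma> = dual_coset G H \<gamma>' \<longleftrightarrow> (\<forall>h\<in>H. \<gamma> h = \<gamma>' h)"
  using assms(2,3) by (auto simp: dual_coset_eq[OF assms(1)])

text \<open>Character values are nonzero and cancel; extensionality settles the points outside the
  carrier.\<close>

lemma inj_on_dual_coset:
  assumes \<gamma>: "\<gamma> \<in> characters G"
  shows "inj_on (\<lambda>\<eta>. \<lambda>g\<in>carrier G. \<gamma> g * \<eta> g) (annihilator G H)"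
proof (rule inj_onI)
  fix \<eta> \<eta>' assume *: "\<eta> \<in> annihilator G H" "\<eta>' \<in> annihilator G H"
    "(\<lambda>g\<in>carrier G. \<gamma> g * \<eta> g) = (\<lambda>g\<in>carrier G. \<gamma> g * \<eta>' g)"
  show "\<eta> = \<eta>'"
  proof
    fix g show "\<eta> g = \<eta>' g"
    proof (cases "g \<in> carrier G")
      case True
      moreover have "\<gamma> g \<noteq> 0" using hom_circle_cnj_mult[OF characters_hom[OF \<gamma>] True] by auto
      ultimately show ?thesis using fun_cong[OF *(3), of g] by simp
    next
      case False
      thus ?thesis using *(1,2) by (auto simp: annihilator_iff characters_def extensional_def)
    qed
  qed
qed

section \<open>Difference counts and their Fourier transforms\<close>

lemma sum_num_differences:
  fixes \<phi> :: "'a \<Rightarrow> complex"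
  assumes A: "A \<subseteq> carrier G"
  shows "(\<Sum>a\<in>A. \<Sum>a'\<in>A. \<phi> (a \<otimes> inv a')) =
    (\<Sum>g\<in>carrier G. of_nat (num_differences G A g) * \<phi> g)"
proof -
  have fin: "finite (A \<times> A)" using finite_subset[OF A] by simp
  let ?f = "\<lambda>(a, a'). a \<otimes> inv a'"
  have "(\<Sum>a\<in>A. \<Sum>a'\<in>A. \<phi> (a \<otimes> inv a')) = (\<Sum>p\<in>A \<times> A. \<phi> (?f p))"
    by (simp add: sum.cartesian_product case_prod_unfold)
  also have "\<dots> = (\<Sum>g\<in>carrier G. \<Sum>p\<in>{p \<in> A \<times> A. ?f p = g}. \<phi> (?f p))"
    by (rule sum.group[symmetric]) (use fin A in auto)
  also have "\<dots> = (\<Sum>g\<in>carrier G. of_nat (num_differences G A g) * \<phi> g)"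
  proof (rule sum.cong[OF refl])
    fix g
    have "{p \<in> A \<times> A. ?f p = g} = {(a, a'). a \<in> A \<and> a' \<in> A \<and> g = a \<otimes> inv a'}" by auto
    moreover have "(\<Sum>p\<in>{p \<in> A \<times> A. ?f p = g}. \<phi> (?f p)) = (\<Sum>p\<in>{p \<in> A \<times> A. ?f p = g}. \<phi> g)"
      by (rule sum.cong) auto
    ultimately show "(\<Sum>p\<in>{p \<in> A \<times> A. ?f p = g}. \<phi> (?f p)) = of_nat (num_differences G A g) * \<phi> g"
      by (simp add: num_differences_def)
  qed
  finally show ?thesis .
qed

text \<open>The squared modulus is a double sum of \<open>\<gamma> (a \<otimes> inv a')\<close>,
  which is then grouped by differences: the power spectrum of a set is the transform of its
  autocorrelation.\<close>

lemma norm_sum_hom_circle: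
  assumes A: "A \<subseteq> carrier G" and \<gamma>: "\<gamma> \<in> hom G circle_group"
  shows "of_real ((cmod (\<Sum>a\<in>A. \<gamma> a))\<^sup>2) =
    (\<Sum>g\<in>carrier G. of_nat (num_differences G A g) * \<gamma> g)"
proof -
  have "of_real ((cmod (\<Sum>a\<in>A. \<gamma> a))\<^sup>2) = (\<Sum>a\<in>A. \<Sum>a'\<in>A. \<gamma> a * cnj (\<gamma> a'))"
    unfolding complex_norm_square by (simp add: sum_product)
  also have "\<dots> = (\<Sum>a\<in>A. \<Sum>a'\<in>A. \<gamma> (a \<otimes> inv a'))"
    using A by (intro sum.cong refl hom_circle_diff[OF \<gamma>, symmetric]) auto
  finally show ?thesis using sum_num_differences[OF A] by simp
qed

lemma num_differences_one:
  assumes "A \<subseteq> carrier G" shows "num_differences G A \<one> = card A"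
proof -
  have "{(a, a'). a \<in> A \<and> a' \<in> A \<and> \<one> = a \<otimes> inv a'} = (\<lambda>a. (a, a)) ` A"
  proof -
    have "a = a'" if "a \<in> A" "a' \<in> A" "\<one> = a \<otimes> inv a'" for a a'
      using that assms by (metis inv_closed inv_equality inv_inv subsetD)
    thus ?thesis using assms by auto
  qed
  thus ?thesis unfolding num_differences_def by (simp add: card_image inj_on_def)
qed

lemma num_differences_eq_0_iff:
  assumes "A \<subseteq> carrier G"
  shows "num_differences G A g = 0 \<longleftrightarrow> \<not> (\<exists>a\<in>A. \<exists>a'\<in>A. g = a \<otimes> inv a')"
proof -
  have "finite {(a, a'). a \<in> A \<and> a' \<in> A \<and> g = a \<otimes> inv a'}"
    by (rule finite_subset[of _ "A \<times> A"]) (use finite_subset[OF assms] in auto)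
  thus ?thesis by (auto simp: num_differences_def)
qed

text \<open>A nontrivial character gives \<open>card B - \<Lambda>\<close> for the squared modulus,
  and counting all pairs gives a second equation for \<Lambda>. Eliminating \<Lambda> leaves an
  identity free of division.\<close>

lemma norm_sum_difference_set:
  assumes B: "difference_set G B" and \<gamma>: "\<gamma> \<in> hom G circle_group"
    and x: "x \<in> carrier G" "\<gamma> x \<noteq> 1"
  shows "(cmod (\<Sum>b\<in>B. \<gamma> b))\<^sup>2 * (real (order G) - 1) =
    real (card B) * (real (order G) - real (card B))"
proof -
  obtain \<Lambda> where \<Lambda>: "\<And>g. g \<in> carrier G - {\<one>} \<Longrightarrow> num_differences G B g = \<Lambda>"
    and BG: "B \<subseteq> carrier G"
    using B unfolding difference_set_def by blast
  have sum: "(\<Sum>g\<in>carrier G. of_nat (num_differences G B g) * \<phi> g) =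
      of_nat (card B) * \<phi> \<one> + of_nat \<Lambda> * ((\<Sum>g\<in>carrier G. \<phi> g) - \<phi> \<one>)" for \<phi> :: "'a \<Rightarrow> complex"
  proof -
    have "(\<Sum>g\<in>carrier G - {\<one>}. of_nat (num_differences G B g) * \<phi> g) =
        of_nat \<Lambda> * (\<Sum>g\<in>carrier G - {\<one>}. \<phi> g)"
      by (simp add: \<Lambda> sum_distrib_left)
    thus ?thesis
      by (simp add: sum.remove[of "carrier G" \<one>] num_differences_one[OF BG])
  qed
  have "of_real ((cmod (\<Sum>b\<in>B. \<gamma> b))\<^sup>2) = (of_real (real (card B) - real \<Lambda>) :: complex)"
    unfolding norm_sum_hom_circle[OF BG \<gamma>] sum sum_hom_circle_eq_0[OF \<gamma> x] hom_circle_one[OF \<gamma>]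
    by simp
  hence 1: "(cmod (\<Sum>b\<in>B. \<gamma> b))\<^sup>2 = real (card B) - real \<Lambda>" using of_real_eq_iff by blast
  \<comment> \<open>The constant function 1 in place of the character counts all ordered
    pairs.\<close>
  have "(of_real ((real (card B))\<^sup>2) :: complex) =
      of_real (real (card B) + real \<Lambda> * (real (order G) - 1))"
    using sum_num_differences[OF BG, of "\<lambda>_. 1"] unfolding sum
    by (simp add: order_def power2_eq_square)
  hence 2: "(real (card B))\<^sup>2 = real (card B) + real \<Lambda> * (real (order G) - 1)"
    using of_real_eq_iff by blast
  show ?thesis unfolding 1 using 2 by (simp add: algebra_simps power2_eq_square)
qed

section \<open>Restriction of characters to subgroups\<close>

lemma subgroup_finite_comm_group:
  assumes "subgroup K G" shows "finite_comm_group (G\<lparr>carrier := K\<rparr>)"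
proof -
  interpret K: group "G\<lparr>carrier := K\<rparr>" using subgroup_imp_group[OF assms] .
  have "comm_group (G\<lparr>carrier := K\<rparr>)"
    by (rule K.group_comm_groupI) (use subgroup.mem_carrier[OF assms] in \<open>simp add: m_comm\<close>)
  thus ?thesis
    using finite_subset[OF subgroup.subset[OF assms] finite_carrier]
    by (simp add: finite_comm_group_def finite_comm_group_axioms_def)
qed

lemma hom_circle_subgroup:
  assumes "subgroup K G" "\<gamma> \<in> hom G circle_group"
  shows "\<gamma> \<in> hom (G\<lparr>carrier := K\<rparr>) circle_group"
  using assms(2) subgroup.mem_carrier[OF assms(1)] by (auto simp: hom_circle_iff)

lemma sum_subgroup_hom_circle_eq_0:
  assumes "subgroup K G" "\<gamma> \<in> hom G circle_group" "h \<in> K" "\<gamma> h \<noteq> 1"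
  shows "(\<Sum>k\<in>K. \<gamma> k) = 0"
  using finite_comm_group.sum_hom_circle_eq_0[OF subgroup_finite_comm_group[OF assms(1)]
      hom_circle_subgroup[OF assms(1,2)]] assms(3,4) by simp

end

subsection \<open>Transversals and the spectral condition\<close>

text \<open>The relation S = G/H - 1 is kept as a product of natural numbers in
  \<open>order_eq\<close>, and properness of \<open>H\<close> as \<open>S > 0\<close>.\<close>

locale subset_modulo_subgroup = finite_comm_group +
  fixes H A :: "'a set" and S :: nat
  assumes H: "subgroup H G" and A: "A \<subseteq> carrier G" and card_A: "card A = S"
    and order_eq: "order G = card H * (S + 1)" and S_pos: "S > 0"
begin

lemma HG: "h \<in> H \<Longrightarrow> h \<in> carrier G" using subgroup.mem_carrier[OF H] .
lemma AG: "a \<in> A \<Longrightarrow> a \<in> carrier G" using A by auto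
lemma finite_A [simp]: "finite A" using finite_subset[OF A] by simp
lemma finite_H [simp]: "finite H" using finite_subset[OF subgroup.subset[OF H]] by simp
lemma card_H_pos: "card H > 0" using subgroup.one_closed[OF H] by (auto simp: card_gt_0_iff)

lemma card_annihilator_H: "card (annihilator G H) = S + 1"
proof -
  have "card (annihilator G H) * card H = (S + 1) * card H"
    using card_annihilator[OF H] order_eq by (metis mult.commute)
  thus ?thesis using card_H_pos by (metis less_numeral_extra(3) mult_right_cancel)
qed

text \<open>These are the three ranges on which the difference counts of a simplicial RDS are
  constant.\<close>

lemma carrier_decomp:
  "(\<Sum>g\<in>carrier G. \<phi> g) = \<phi> \<one> + (\<Sum>g\<in>H - {\<one>}. \<phi> g) + (\<Sum>g\<in>carrier G - H. \<phi> g :: complex)"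
proof -
  have "(\<Sum>g\<in>carrier G. \<phi> g) = (\<Sum>g\<in>carrier G - H. \<phi> g) + (\<Sum>g\<in>H. \<phi> g)"
    by (rule sum.subset_diff) (use subgroup.subset[OF H] in auto)
  moreover have "(\<Sum>g\<in>H. \<phi> g) = \<phi> \<one> + (\<Sum>g\<in>H - {\<one>}. \<phi> g)"
    by (rule sum.remove) (use subgroup.one_closed[OF H] in auto)
  ultimately show ?thesis by simp
qed

text \<open>As \<open>card A = S\<close> is the number of nonidentity cosets, \<open>spread\<close> already makes \<open>A\<close> a set of
  representatives of them.\<close>

definition spread :: bool where
  "spread \<longleftrightarrow> A \<inter> H = {} \<and> (\<forall>a\<in>A. \<forall>a'\<in>A. a \<otimes> inv a' \<in> H \<longrightarrow> a = a')"

text \<open>Distinct members of \<open>A\<close> lie in distinct cosets of \<open>H\<close>, none of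
  them \<open>H\<close> itself, so the map is injective with image outside \<open>H\<close>. Both
  sides have \<open>S * card H\<close> elements, which yields surjectivity.\<close>

lemma bij_betw_spread:
  assumes spread
  shows "bij_betw (\<lambda>(a, h). h \<otimes> a) (A \<times> H) (carrier G - H)"
proof -
  have inj: "inj_on (\<lambda>(a, h). h \<otimes> a) (A \<times> H)"
  proof (rule inj_onI, clarify)
    fix a h a' h' assume *: "a \<in> A" "h \<in> H" "a' \<in> A" "h' \<in> H" "h \<otimes> a = h' \<otimes> a'"
    have "a = inv h \<otimes> (h' \<otimes> a')" using * AG HG by (metis inv_solve_left m_closed)
    hence "a = (inv h \<otimes> h') \<otimes> a'" using * AG HG by (simp add: m_assoc)
    hence "a \<otimes> inv a' = inv h \<otimes> h'" using * AG HG by (metis inv_closed inv_solve_right m_closed)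
    hence "a \<otimes> inv a' \<in> H" using * H by (simp add: subgroup.m_closed subgroup.m_inv_closed)
    hence "a = a'" using assms * unfolding spread_def by blast
    thus "a = a' \<and> h = h'" using * AG HG by (metis right_cancel)
  qed
  have sub: "(\<lambda>(a, h). h \<otimes> a) ` (A \<times> H) \<subseteq> carrier G - H"
  proof clarify
    fix a h assume *: "a \<in> A" "h \<in> H"
    have "a \<in> H" if "h \<otimes> a \<in> H"
    proof -
      have "a = inv h \<otimes> (h \<otimes> a)" using * AG HG by (metis inv_solve_left m_closed)
      thus ?thesis using * that H by (metis subgroup.m_closed subgroup.m_inv_closed)
    qed
    thus "h \<otimes> a \<in> carrier G - H" using * AG HG assms unfolding spread_def by blast
  qed
  have "card (carrier G - H) = S * card H"
    using card_Diff_subset[OF finite_H subgroup.subset[OF H]] order_eq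
    by (simp add: order_def algebra_simps)
  hence "(\<lambda>(a, h). h \<otimes> a) ` (A \<times> H) = carrier G - H"
    using sub by (intro card_subset_eq) (simp_all add: card_image[OF inj] card_cartesian_product card_A)
  thus ?thesis using inj by (simp add: bij_betw_def)
qed

lemma sum_outside_H:
  assumes spread
  shows "(\<Sum>g\<in>carrier G - H. \<phi> g) = (\<Sum>a\<in>A. \<Sum>h\<in>H. \<phi> (h \<otimes> a) :: complex)"
  using sum.reindex_bij_betw[OF bij_betw_spread[OF assms], of \<phi>]
  by (simp add: sum.cartesian_product case_prod_unfold)

text \<open>\<open>\<gamma>\<close> is constant on cosets of \<open>H\<close> and its sum over the
  group vanishes. That sum is \<open>card H\<close>, contributed by \<open>H\<close>, plus
  \<open>card H\<close> times the sum over \<open>A\<close>.\<close>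

lemma sum_annihilator_spread:
  assumes spread and \<gamma>: "\<gamma> \<in> annihilator G H" "\<gamma> \<noteq> (\<lambda>g\<in>carrier G. 1)"
  shows "(\<Sum>a\<in>A. \<gamma> a) = -1"
proof -
  have \<gamma>': "\<gamma> \<in> characters G" "\<And>h. h \<in> H \<Longrightarrow> \<gamma> h = 1" using \<gamma> by (auto simp: annihilator_iff)
  have "0 = (\<Sum>g\<in>carrier G. \<gamma> g)" using sum_character[OF \<gamma>'(1)] \<gamma>(2) by simp
  also have "\<dots> = (\<Sum>g\<in>carrier G - H. \<gamma> g) + (\<Sum>g\<in>H. \<gamma> g)"
    by (rule sum.subset_diff) (use subgroup.subset[OF H] in auto)
  also have "(\<Sum>g\<in>carrier G - H. \<gamma> g) = (\<Sum>a\<in>A. \<Sum>h\<in>H. \<gamma> a)"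
    unfolding sum_outside_H[OF assms(1)] using AG HG \<gamma>'(2)
    by (intro sum.cong refl) (simp add: hom_circle_mult[OF characters_hom[OF \<gamma>'(1)]])
  also have "(\<Sum>g\<in>H. \<gamma> g) = of_nat (card H)" using \<gamma>'(2) by simp
  finally have "of_nat (card H) * ((\<Sum>a\<in>A. \<gamma> a) + 1) = 0"
    by (simp add: sum_distrib_right[symmetric] algebra_simps)
  thus ?thesis using card_H_pos by (auto simp: eq_neg_iff_add_eq_0)
qed

lemma spread_num_differences:
  assumes spread "h \<in> H - {\<one>}" shows "num_differences G A h = 0"
  unfolding num_differences_eq_0_iff[OF A] using assms AG unfolding spread_def by fastforce

text \<open>Two members of \<open>A\<close> in one coset must coincide, which gives
  \<open>spread\<close>. Conversely \<open>bij_betw_spread\<close> finds the representative in each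
  coset other than \<open>H\<close>, and \<open>spread\<close> excludes nonidentity differences in
  \<open>H\<close>.\<close>

lemma simplicial_RDS_iff:
  "simplicial_RDS G H A \<longleftrightarrow> spread \<and> (\<exists>\<Lambda>. \<forall>g\<in>carrier G - H. num_differences G A g = \<Lambda>)"
proof
  assume s: "simplicial_RDS G H A"
  have "a = a'" if "a \<in> A" "a' \<in> A" "a \<otimes> inv a' \<in> H" for a a'
  proof -
    have "a \<in> H #> a'" using subgroup.rcos_module_rev[OF H is_group] that AG by blast
    hence "H #> a' = H #> a" using repr_independence[OF _ _ H] that AG by blast
    hence "a \<in> A \<inter> (H #> a)" "a' \<in> A \<inter> (H #> a)" using that AG rcos_self[OF _ H] by auto
    moreover have "H #> a \<in> rcosets H - {H}"
      using s that AG coset_join1[OF _ _ H] rcosetsI[OF subgroup.subset[OF H]]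
      unfolding simplicial_RDS_def by blast
    ultimately show ?thesis using s unfolding simplicial_RDS_def by blast
  qed
  thus "spread \<and> (\<exists>\<Lambda>. \<forall>g\<in>carrier G - H. num_differences G A g = \<Lambda>)"
    using s unfolding simplicial_RDS_def relative_difference_set_def spread_def by blast
next
  assume s: "spread \<and> (\<exists>\<Lambda>. \<forall>g\<in>carrier G - H. num_differences G A g = \<Lambda>)"
  have "\<exists>!a. a \<in> A \<inter> K" if K: "K \<in> rcosets H - {H}" for K
  proof -
    obtain x where x: "x \<in> carrier G" "K = H #> x" using K by (auto simp: RCOSETS_def)
    have "x \<notin> H" using K x coset_join2[OF _ H] by blast
    hence "x \<in> (\<lambda>(a, h). h \<otimes> a) ` (A \<times> H)"
      using bij_betw_imp_surj_on[OF bij_betw_spread] s x by blast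
    then obtain a h where ah: "a \<in> A" "h \<in> H" "x = h \<otimes> a" by auto
    have Ka: "K = H #> a"
      using repr_independence[of x H a] ah x H AG by (metis rcosI subgroup.subset)
    show ?thesis
    proof (rule ex1I[of _ a])
      show "a \<in> A \<inter> K" using Ka ah AG rcos_self[OF _ H] by auto
      fix a' assume "a' \<in> A \<inter> K"
      thus "a' = a"
        using Ka s subgroup.rcos_module_imp[OF H is_group] ah AG unfolding spread_def by blast
    qed
  qed
  moreover have "\<not> (\<exists>a\<in>A. \<exists>a'\<in>A. h = a \<otimes> inv a')" if "h \<in> H - {\<one>}" for h
    using spread_num_differences num_differences_eq_0_iff[OF A] s that by blast
  ultimately show "simplicial_RDS G H A"
    using s A unfolding simplicial_RDS_def relative_difference_set_def spread_def by blast
qed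

text \<open>The count is \<open>S\<close> at the identity, zero on the rest of \<open>H\<close> and
  \<Lambda> outside \<open>H\<close>.\<close>

lemma sum_num_differences_RDS:
  assumes spread and \<Lambda>: "\<And>g. g \<in> carrier G - H \<Longrightarrow> num_differences G A g = \<Lambda>"
  shows "(\<Sum>g\<in>carrier G. of_nat (num_differences G A g) * \<phi> g) =
    of_nat S * \<phi> \<one> + of_nat \<Lambda> * (\<Sum>g\<in>carrier G - H. \<phi> g :: complex)"
  unfolding carrier_decomp[of "\<lambda>g. of_nat (num_differences G A g) * \<phi> g"]
  by (simp add: num_differences_one[OF A] card_A spread_num_differences[OF assms(1)]
      \<Lambda> sum_distrib_left)

text \<open>Condition (ii) without the complex conjugate in the transform; neither the value -1 nor
  the modulus changes under conjugation.\<close>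

definition spectral :: bool where
  "spectral \<longleftrightarrow>
    (\<forall>\<gamma>\<in>annihilator G H. \<gamma> \<noteq> (\<lambda>g\<in>carrier G. 1) \<longrightarrow> (\<Sum>a\<in>A. \<gamma> a) = -1) \<and>
    (\<forall>\<gamma>\<in>characters G - annihilator G H. cmod (\<Sum>a\<in>A. \<gamma> a) = sqrt (real S))"

lemma sums_not_annihilator:
  assumes "\<gamma> \<in> characters G - annihilator G H"
  shows "(\<Sum>h\<in>H. \<gamma> h) = 0" "(\<Sum>g\<in>carrier G. \<gamma> g) = 0" "(\<Sum>g\<in>carrier G - H. \<gamma> g) = 0"
proof -
  obtain h where h: "h \<in> H" "\<gamma> h \<noteq> 1" using assms by (auto simp: annihilator_iff)
  have \<gamma>: "\<gamma> \<in> hom G circle_group" using assms characters_hom by blast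
  show 1: "(\<Sum>h\<in>H. \<gamma> h) = 0" using sum_subgroup_hom_circle_eq_0[OF H \<gamma> h] .
  show 2: "(\<Sum>g\<in>carrier G. \<gamma> g) = 0" using sum_hom_circle_eq_0[OF \<gamma> HG h(2)] h by simp
  show "(\<Sum>g\<in>carrier G - H. \<gamma> g) = 0"
    using 1 2 sum.subset_diff[OF subgroup.subset[OF H] finite_carrier, of \<gamma>] by simp
qed

text \<open>For a character nontrivial on \<open>H\<close> the sum outside \<open>H\<close>
  vanishes, so the transform of the counts retains only the term \<open>S\<close> at the
  identity.\<close>

lemma simplicial_RDS_imp_spectral:
  assumes "simplicial_RDS G H A" shows spectral
proof -
  obtain \<Lambda> where s: spread and \<Lambda>: "\<And>g. g \<in> carrier G - H \<Longrightarrow> num_differences G A g = \<Lambda>"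
    using assms unfolding simplicial_RDS_iff by blast
  have "cmod (\<Sum>a\<in>A. \<gamma> a) = sqrt (real S)" if \<gamma>: "\<gamma> \<in> characters G - annihilator G H" for \<gamma>
  proof -
    have h: "\<gamma> \<in> hom G circle_group" using \<gamma> characters_hom by blast
    have "(of_real ((cmod (\<Sum>a\<in>A. \<gamma> a))\<^sup>2) :: complex) = of_real (real S)"
      unfolding norm_sum_hom_circle[OF A h]
      using sum_num_differences_RDS[OF s \<Lambda>, of \<gamma>] sums_not_annihilator(3)[OF \<gamma>] hom_circle_one[OF h]
      by simp
    hence "(cmod (\<Sum>a\<in>A. \<gamma> a))\<^sup>2 = real S" using of_real_eq_iff by blast
    thus ?thesis by (metis norm_ge_zero real_sqrt_unique)
  qed
  thus ?thesis using sum_annihilator_spread[OF s] unfolding spectral_def by blast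
qed

lemma one_in_annihilator: "(\<lambda>g\<in>carrier G. 1) \<in> annihilator G H"
  using characters_one HG by (auto simp: annihilator_iff)

lemma sum_A_one: "(\<Sum>a\<in>A. (\<lambda>g\<in>carrier G. 1 :: complex) a) = of_nat S"
  using AG card_A by simp

text \<open>The character sums over \<open>A\<close>, added up over the annihilator, give
  \<open>S\<close> from the trivial character and -1 from each of the \<open>S\<close> others, hence
  zero. By orthogonality the same total is \<open>S + 1\<close> times the size of
  \<open>A \<inter> H\<close>.\<close>

lemma spectral_disjoint:
  assumes spectral shows "A \<inter> H = {}"
proof -
  have "(\<Sum>\<gamma>\<in>annihilator G H. \<Sum>a\<in>A. \<gamma> a) =
      of_nat S + (\<Sum>\<gamma>\<in>annihilator G H - {\<lambda>g\<in>carrier G. 1}. \<Sum>a\<in>A. \<gamma> a)"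
    using sum.remove[OF finite_annihilator one_in_annihilator, of "\<lambda>\<gamma>. \<Sum>a\<in>A. \<gamma> a"]
    unfolding sum_A_one .
  also have "(\<Sum>\<gamma>\<in>annihilator G H - {\<lambda>g\<in>carrier G. 1}. \<Sum>a\<in>A. \<gamma> a) =
      (\<Sum>\<gamma>\<in>annihilator G H - {\<lambda>g\<in>carrier G. 1}. -1)"
    using assms unfolding spectral_def by (intro sum.cong) auto
  also have "\<dots> = - of_nat S"
    using one_in_annihilator card_annihilator_H finite_annihilator by simp
  finally have "0 = (\<Sum>a\<in>A. \<Sum>\<gamma>\<in>annihilator G H. \<gamma> a)"
    by (subst sum.swap) simp
  also have "\<dots> = (\<Sum>a\<in>A. if a \<in> H then of_nat (S + 1) else 0)"
    using AG by (intro sum.cong refl) (simp add: sum_annihilator[OF H] card_annihilator_H)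
  also have "\<dots> = of_nat (S + 1) * of_nat (card (A \<inter> H))"
    by (simp add: sum.If_cases Int_def)
  finally have "card (A \<inter> H) = 0" by (metis Suc_eq_plus1 mult_eq_0_iff nat.simps(3) of_nat_eq_0_iff)
  thus ?thesis by simp
qed

text \<open>The expected count function \<open>v\<close> and the actual one have the same Fourier
  coefficients, so inversion identifies them.\<close>

lemma spectral_num_differences:
  assumes spectral and x: "x \<in> carrier G"
  shows "real (num_differences G A x) =
    (if x = \<one> then real S else if x \<in> H then 0 else (real S - 1) / real (card H))"
proof -
  \<comment> \<open>The \<open>S * (S - 1)\<close> ordered pairs of distinct members must be shared
    equally by the \<open>S * card H\<close> elements outside \<open>H\<close>.\<close>
  define \<Lambda> :: complex where "\<Lambda> = (of_nat S - 1) / of_nat (card H)"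
  define v :: "'a \<Rightarrow> complex" where "v g = (if g = \<one> then of_nat S else if g \<in> H then 0 else \<Lambda>)" for g
  have \<Lambda>: "\<Lambda> * of_nat (card H) = of_nat S - 1" using card_H_pos by (auto simp: \<Lambda>_def)
  have v: "(\<Sum>g\<in>carrier G. v g * \<phi> g) = of_nat S * \<phi> \<one> + \<Lambda> * (\<Sum>g\<in>carrier G - H. \<phi> g)" for \<phi>
  proof -
    have "(\<Sum>g\<in>H - {\<one>}. v g * \<phi> g) = 0" by (intro sum.neutral) (auto simp: v_def)
    moreover have "(\<Sum>g\<in>carrier G - H. v g * \<phi> g) = (\<Sum>g\<in>carrier G - H. \<Lambda> * \<phi> g)"
      using subgroup.one_closed[OF H] by (intro sum.cong) (auto simp: v_def)
    ultimately show ?thesis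
      unfolding carrier_decomp[of "\<lambda>g. v g * \<phi> g"] by (simp add: v_def sum_distrib_left)
  qed
  have cardGH: "(of_nat (card (carrier G - H)) :: complex) = of_nat S * of_nat (card H)"
    using card_Diff_subset[OF finite_H subgroup.subset[OF H]] order_eq
    by (simp add: order_def algebra_simps)
  have eq: "(\<Sum>g\<in>carrier G. \<gamma> g * of_nat (num_differences G A g)) = (\<Sum>g\<in>carrier G. \<gamma> g * v g)"
    if \<gamma>: "\<gamma> \<in> characters G" for \<gamma>
  proof -
    have h: "\<gamma> \<in> hom G circle_group" using \<gamma> characters_hom by blast
    \<comment> \<open>Both transforms equal S^2 at the trivial character, 1 on the rest of the
      annihilator and S elsewhere.\<close>
    consider "\<gamma> = (\<lambda>g\<in>carrier G. 1)" | "\<gamma> \<in> annihilator G H" "\<gamma> \<noteq> (\<lambda>g\<in>carrier G. 1)"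
      | "\<gamma> \<in> characters G - annihilator G H" using \<gamma> by blast
    hence "of_real ((cmod (\<Sum>a\<in>A. \<gamma> a))\<^sup>2) = of_nat S + \<Lambda> * (\<Sum>g\<in>carrier G - H. \<gamma> g)"
    proof cases
      case 1
      have "(\<Sum>g\<in>carrier G - H. \<gamma> g) = of_nat S * of_nat (card H)" using cardGH by (simp add: 1)
      hence "of_nat S + \<Lambda> * (\<Sum>g\<in>carrier G - H. \<gamma> g) = of_nat S + of_nat S * (\<Lambda> * of_nat (card H))"
        by simp
      thus ?thesis unfolding 1 sum_A_one \<Lambda> by (simp add: algebra_simps power2_eq_square)
    next
      case 2
      have "(\<Sum>g\<in>carrier G. \<gamma> g) = 0" using sum_character[OF \<gamma>] 2 by simp
      moreover have "(\<Sum>g\<in>H. \<gamma> g) = of_nat (card H)" using 2 by (simp add: annihilator_iff)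
      ultimately have "(\<Sum>g\<in>carrier G - H. \<gamma> g) = - of_nat (card H)"
        using sum.subset_diff[OF subgroup.subset[OF H] finite_carrier, of \<gamma>]
        by (simp add: eq_neg_iff_add_eq_0)
      moreover have "(\<Sum>a\<in>A. \<gamma> a) = -1" using assms(1) 2 unfolding spectral_def by blast
      ultimately show ?thesis using \<Lambda> by simp
    next
      case 3
      hence "cmod (\<Sum>a\<in>A. \<gamma> a) = sqrt (real S)" using assms(1) unfolding spectral_def by blast
      thus ?thesis using sums_not_annihilator(3)[OF 3] by (simp flip: of_real_power)
    qed
    thus ?thesis
      unfolding norm_sum_hom_circle[OF A h] using v[of \<gamma>] hom_circle_one[OF h]
      by (simp add: mult.commute)
  qed
  have "of_nat (order G) * of_nat (num_differences G A x) = of_nat (order G) * v x"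
    unfolding fourier_inversion[OF x, of v, symmetric]
      fourier_inversion[OF x, of "\<lambda>g. of_nat (num_differences G A g)", symmetric]
    using eq by (intro sum.cong) auto
  moreover have "order G \<noteq> 0" using order_eq card_H_pos by auto
  ultimately have "of_nat (num_differences G A x) = v x" by simp
  hence "complex_of_real (real (num_differences G A x)) = complex_of_real
      (if x = \<one> then real S else if x \<in> H then 0 else (real S - 1) / real (card H))"
    by (auto simp: v_def \<Lambda>_def)
  thus ?thesis using of_real_eq_iff by blast
qed

text \<open>Nonidentity elements of \<open>H\<close> have count zero, so two members of
  \<open>A\<close> in one coset coincide; the count outside \<open>H\<close> is a constant.\<close>

lemma spectral_imp_simplicial_RDS:
  assumes spectral shows "simplicial_RDS G H A"
proof -
  have "a = a'" if a: "a \<in> A" "a' \<in> A" "a \<otimes> inv a' \<in> H" for a a'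
  proof -
    have "a \<otimes> inv a' \<in> carrier G" using a AG by simp
    moreover have "num_differences G A (a \<otimes> inv a') \<noteq> 0"
      unfolding num_differences_eq_0_iff[OF A] using a by blast
    ultimately have "a \<otimes> inv a' = \<one>"
      using spectral_num_differences[OF assms, of "a \<otimes> inv a'"] a(3) by (simp split: if_splits)
    thus ?thesis using a AG by (metis inv_closed inv_equality inv_inv)
  qed
  hence s: spread using spectral_disjoint[OF assms] unfolding spread_def by blast
  have "real (num_differences G A g) = (real S - 1) / real (card H)" if "g \<in> carrier G - H" for g
    using spectral_num_differences[OF assms, of g] that subgroup.one_closed[OF H] by auto
  hence "num_differences G A g = num_differences G A g'"
    if "g \<in> carrier G - H" "g' \<in> carrier G - H" for g g' using that by (metis of_nat_eq_iff)
  thus ?thesis using s unfolding simplicial_RDS_iff by blast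
qed

subsection \<open>Frames\<close>

definition \<xi> :: "('a \<Rightarrow> complex) \<Rightarrow> 'a \<Rightarrow> complex" where
  "\<xi> \<gamma> a = 1 / of_real (sqrt (real S)) * \<gamma> a"

lemma cnj_\<xi>_mult: "cnj (\<xi> \<gamma> a) * \<xi> \<gamma>' a' = cnj (\<gamma> a) * \<gamma>' a' / of_nat S"
proof -
  have "complex_of_real (sqrt (real S)) * complex_of_real (sqrt (real S)) = of_nat S"
    by (simp flip: of_real_mult)
  thus ?thesis by (simp add: \<xi>_def)
qed

text \<open>The product is restricted to the carrier so that it is itself an element of
  \<open>characters G\<close>, to which \<open>spectral\<close> applies.\<close>

lemma inner_on_\<xi>:
  "inner_on A (\<xi> \<gamma>) (\<xi> \<gamma>') = (\<Sum>a\<in>A. (\<lambda>g\<in>carrier G. cnj (\<gamma> g) * \<gamma>' g) a) / of_nat S"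
  using AG by (simp add: inner_on_def cnj_\<xi>_mult sum_divide_distrib)

lemma norm_on_eq: "(norm_on A x)\<^sup>2 = (\<Sum>a\<in>A. (cmod (x a))\<^sup>2)"
proof -
  have "inner_on A x x = of_real (\<Sum>a\<in>A. (cmod (x a))\<^sup>2)"
    unfolding inner_on_def of_real_sum complex_norm_square by (simp add: mult.commute)
  thus ?thesis by (simp add: norm_on_def sum_nonneg)
qed

lemma norm_on_\<xi>:
  assumes "\<gamma> \<in> characters G" shows "norm_on A (\<xi> \<gamma>) = 1"
proof -
  have "(norm_on A (\<xi> \<gamma>))\<^sup>2 = (\<Sum>a\<in>A. 1 / real S)"
    unfolding norm_on_eq using hom_circle_norm[OF characters_hom[OF assms] AG]
    by (intro sum.cong refl) (simp add: \<xi>_def norm_mult norm_divide power_divide)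
  hence "(norm_on A (\<xi> \<gamma>))\<^sup>2 = 1" using card_A S_pos by simp
  moreover have "norm_on A (\<xi> \<gamma>) \<ge> 0"
    unfolding norm_on_def inner_on_def by (auto intro!: sum_nonneg)
  ultimately show ?thesis by (simp add: power2_eq_1_iff)
qed

lemma finite_dual_coset: "finite (dual_coset G H \<gamma>)"
  by (simp add: dual_coset_image finite_annihilator)

lemma card_dual_coset: "\<gamma> \<in> characters G \<Longrightarrow> card (dual_coset G H \<gamma>) = S + 1"
  by (simp only: dual_coset_image card_image[OF inj_on_dual_coset] card_annihilator_H)

lemma sum_dual_coset:
  assumes "\<gamma> \<in> characters G" "y \<in> carrier G"
  shows "(\<Sum>\<gamma>'\<in>dual_coset G H \<gamma>. \<gamma>' y) = (if y \<in> H then of_nat (S + 1) * \<gamma> y else 0)"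
proof -
  have "(\<Sum>\<gamma>'\<in>dual_coset G H \<gamma>. \<gamma>' y) = \<gamma> y * (\<Sum>\<eta>\<in>annihilator G H. \<eta> y)"
    unfolding dual_coset_image using assms(2)
    by (simp add: sum.reindex[OF inj_on_dual_coset[OF assms(1)]] sum_distrib_left)
  thus ?thesis using sum_annihilator[OF H assms(2)] card_annihilator_H by simp
qed

lemma dual_coset_characters:
  assumes "\<gamma> \<in> characters G" "\<gamma>' \<in> dual_coset G H \<gamma>" shows "\<gamma>' \<in> characters G"
  using assms by (simp add: dual_coset_eq[OF H])

text \<open>Expanding the squares produces the sum of \<open>\<gamma>' (a' \<otimes> inv a)\<close>
  over a coset of the annihilator, which vanishes unless the difference lies in \<open>H\<close>.
  The frame operator thus couples only members of \<open>A\<close> in a common coset of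
  \<open>H\<close>.\<close>

lemma sum_inner_on_\<xi>:
  assumes \<gamma>: "\<gamma> \<in> characters G"
  shows "of_real (\<Sum>\<gamma>'\<in>dual_coset G H \<gamma>. (cmod (inner_on A (\<xi> \<gamma>') x))\<^sup>2) =
    (\<Sum>a\<in>A. \<Sum>a'\<in>A. if a' \<otimes> inv a \<in> H
       then of_nat (S + 1) / of_nat S * \<gamma> (a' \<otimes> inv a) * (x a * cnj (x a')) else 0)"
proof -
  have "of_real (\<Sum>\<gamma>'\<in>dual_coset G H \<gamma>. (cmod (inner_on A (\<xi> \<gamma>') x))\<^sup>2) =
      (\<Sum>\<gamma>'\<in>dual_coset G H \<gamma>. \<Sum>a\<in>A. \<Sum>a'\<in>A. \<gamma>' (a' \<otimes> inv a) * (x a * cnj (x a') / of_nat S))"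
    unfolding of_real_sum
  proof (rule sum.cong[OF refl])
    fix \<gamma>' assume "\<gamma>' \<in> dual_coset G H \<gamma>"
    hence \<gamma>': "\<gamma>' \<in> hom G circle_group" using dual_coset_characters[OF \<gamma>] characters_hom by blast
    have "of_real ((cmod (inner_on A (\<xi> \<gamma>') x))\<^sup>2) =
        (\<Sum>a\<in>A. \<Sum>a'\<in>A. (cnj (\<xi> \<gamma>' a) * \<xi> \<gamma>' a') * (x a * cnj (x a')))"
      unfolding complex_norm_square inner_on_def cnj_sum sum_product
      by (intro sum.cong refl) (simp add: mult_ac)
    also have "\<dots> = (\<Sum>a\<in>A. \<Sum>a'\<in>A. \<gamma>' (a' \<otimes> inv a) * (x a * cnj (x a') / of_nat S))"
      unfolding cnj_\<xi>_mult using AG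
      by (intro sum.cong refl) (simp add: hom_circle_diff[OF \<gamma>'] mult_ac)
    finally show "of_real ((cmod (inner_on A (\<xi> \<gamma>') x))\<^sup>2) =
        (\<Sum>a\<in>A. \<Sum>a'\<in>A. \<gamma>' (a' \<otimes> inv a) * (x a * cnj (x a') / of_nat S))" .
  qed
  also have "\<dots> = (\<Sum>a\<in>A. \<Sum>a'\<in>A. \<Sum>\<gamma>'\<in>dual_coset G H \<gamma>. \<gamma>' (a' \<otimes> inv a) * (x a * cnj (x a') / of_nat S))"
    by (subst sum.swap, intro sum.cong refl, rule sum.swap)
  also have "\<dots> = (\<Sum>a\<in>A. \<Sum>a'\<in>A. if a' \<otimes> inv a \<in> H
       then of_nat (S + 1) / of_nat S * \<gamma> (a' \<otimes> inv a) * (x a * cnj (x a')) else 0)"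
    unfolding sum_distrib_right[symmetric] using AG
    by (intro sum.cong refl) (simp add: sum_dual_coset[OF \<gamma>])
  finally show ?thesis .
qed

text \<open>Under \<open>spread\<close> only the diagonal terms survive, which gives a tight frame
  with constant (S+1)/S.\<close>

lemma spread_frame:
  assumes spread and \<gamma>: "\<gamma> \<in> characters G"
  shows "(\<Sum>\<gamma>'\<in>dual_coset G H \<gamma>. (cmod (inner_on A (\<xi> \<gamma>') x))\<^sup>2) =
    (real S + 1) / real S * (norm_on A x)\<^sup>2"
proof -
  have "a' \<otimes> inv a \<in> H \<longleftrightarrow> a = a'" if "a \<in> A" "a' \<in> A" for a a'
    using that assms(1) AG subgroup.one_closed[OF H] unfolding spread_def by auto
  hence "of_real (\<Sum>\<gamma>'\<in>dual_coset G H \<gamma>. (cmod (inner_on A (\<xi> \<gamma>') x))\<^sup>2) =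
      (\<Sum>a\<in>A. of_nat (S + 1) / of_nat S * \<gamma> (a \<otimes> inv a) * (x a * cnj (x a)))"
    unfolding sum_inner_on_\<xi>[OF \<gamma>] by (intro sum_sum_diagonal) auto
  also have "\<dots> = (\<Sum>a\<in>A. of_nat (S + 1) / of_nat S * (x a * cnj (x a)))"
    using AG hom_circle_one[OF characters_hom[OF \<gamma>]] by (intro sum.cong refl) simp
  also have "\<dots> = of_real ((real S + 1) / real S * (norm_on A x)\<^sup>2)"
    unfolding norm_on_eq sum_distrib_left of_real_sum of_real_mult complex_norm_square
    by (simp add: add.commute)
  finally show ?thesis using of_real_eq_iff by blast
qed

definition simplices :: bool where
  "simplices \<longleftrightarrow>
    (\<forall>\<gamma>\<in>characters G. regular_simplex S A (dual_coset G H \<gamma>) \<xi> \<and>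
       (\<forall>a\<in>A. (\<Sum>\<gamma>'\<in>dual_coset G H \<gamma>. \<xi> \<gamma>' a) = 0)) \<and>
    (\<exists>c. \<forall>\<gamma>\<in>characters G. \<forall>\<gamma>'\<in>characters G.
       dual_coset G H \<gamma> \<noteq> dual_coset G H \<gamma>' \<longrightarrow> cmod (inner_on A (\<xi> \<gamma>) (\<xi> \<gamma>')) = c)"

text \<open>The quotient of the two characters is nontrivial on \<open>H\<close>, so its sum over
  \<open>A\<close> has modulus \<open>sqrt S\<close>; the normalisation divides it by
  \<open>S\<close>.\<close>

lemma spectral_unbiased:
  assumes spectral "\<gamma> \<in> characters G" "\<gamma>' \<in> characters G" "dual_coset G H \<gamma> \<noteq> dual_coset G H \<gamma>'"
  shows "cmod (inner_on A (\<xi> \<gamma>) (\<xi> \<gamma>')) = 1 / sqrt (real S)"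
proof -
  let ?\<chi> = "\<lambda>g\<in>carrier G. cnj (\<gamma> g) * \<gamma>' g"
  obtain h where h: "h \<in> H" "\<gamma> h \<noteq> \<gamma>' h"
    using assms(4) unfolding dual_coset_eq_iff[OF H assms(2,3)] by blast
  have "?\<chi> h \<noteq> 1"
  proof
    assume "?\<chi> h = 1"
    hence "cnj (\<gamma> h) * \<gamma>' h = cnj (\<gamma> h) * \<gamma> h"
      using h HG hom_circle_cnj_mult[OF characters_hom[OF assms(2)]] by simp
    moreover have "cnj (\<gamma> h) \<noteq> 0"
      using h HG hom_circle_norm[OF characters_hom[OF assms(2)], of h] by auto
    ultimately show False using h by simp
  qed
  hence "?\<chi> \<in> characters G - annihilator G H"
    using h(1) characters_diff[OF characters_hom characters_hom, OF assms(2,3)]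
    unfolding annihilator_iff Diff_iff by blast
  hence "cmod (\<Sum>a\<in>A. ?\<chi> a) = sqrt (real S)" using assms(1) unfolding spectral_def by blast
  thus ?thesis unfolding inner_on_\<xi> using S_pos by (simp add: norm_divide real_div_sqrt field_simps)
qed

text \<open>The quotient of two distinct members of one coset is a nontrivial element of the
  annihilator, so their inner product is -1/S. Tightness is \<open>spread_frame\<close>, and the
  vectors sum to zero because \<open>A\<close> misses \<open>H\<close>.\<close>

lemma spectral_imp_simplices:
  assumes spectral shows simplices
proof -
  have s: spread using spectral_imp_simplicial_RDS[OF assms] simplicial_RDS_iff by blast
  have "regular_simplex S A (dual_coset G H \<gamma>) \<xi>" if \<gamma>: "\<gamma> \<in> characters G" for \<gamma>
    unfolding regular_simplex_def is_ETF_def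
  proof (intro conjI)
    show "\<forall>n\<in>dual_coset G H \<gamma>. norm_on A (\<xi> n) = 1"
      using norm_on_\<xi> dual_coset_characters[OF \<gamma>] by blast
    show "\<exists>C>0. \<forall>x. C * (norm_on A x)\<^sup>2 = (\<Sum>n\<in>dual_coset G H \<gamma>. (cmod (inner_on A (\<xi> n) x))\<^sup>2)"
      using S_pos by (intro exI[of _ "(real S + 1) / real S"]) (simp add: spread_frame[OF s \<gamma>])
    show "\<exists>c. \<forall>n\<in>dual_coset G H \<gamma>. \<forall>n'\<in>dual_coset G H \<gamma>.
        n \<noteq> n' \<longrightarrow> cmod (inner_on A (\<xi> n) (\<xi> n')) = c"
    proof (intro exI[of _ "1 / real S"] ballI impI)
      fix n n' assume n: "n \<in> dual_coset G H \<gamma>" "n' \<in> dual_coset G H \<gamma>" "n \<noteq> n'"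
      note c = dual_coset_characters[OF \<gamma> n(1)] dual_coset_characters[OF \<gamma> n(2)]
      let ?\<chi> = "\<lambda>g\<in>carrier G. cnj (n g) * n' g"
      have agree: "n h = n' h" if "h \<in> H" for h
        using n(1,2) that unfolding dual_coset_eq[OF H \<gamma>] by simp
      have "?\<chi> \<in> annihilator G H"
        using characters_diff[OF c[THEN characters_hom]] HG agree
          hom_circle_cnj_mult[OF characters_hom[OF c(2)]] by (auto simp: annihilator_iff)
      moreover have "?\<chi> \<noteq> (\<lambda>g\<in>carrier G. 1)"
      proof
        assume eq: "?\<chi> = (\<lambda>g\<in>carrier G. 1)"
        have "n g = n' g" for g
        proof (cases "g \<in> carrier G")
          case True
          hence "cnj (n g) * n' g = cnj (n g) * n g"
            using fun_cong[OF eq, of g] hom_circle_cnj_mult[OF characters_hom[OF c(1)]] by simp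
          moreover have "cnj (n g) \<noteq> 0"
            using True hom_circle_norm[OF characters_hom[OF c(1)], of g] by auto
          ultimately show ?thesis by simp
        next
          case False
          thus ?thesis using c by (auto simp: characters_def extensional_def)
        qed
        thus False using n(3) by blast
      qed
      ultimately have "(\<Sum>a\<in>A. ?\<chi> a) = -1" using assms unfolding spectral_def by blast
      thus "cmod (inner_on A (\<xi> n) (\<xi> n')) = 1 / real S"
        unfolding inner_on_\<xi> by (simp add: norm_divide)
    qed
  qed (simp_all only: finite_A card_A finite_dual_coset card_dual_coset[OF \<gamma>])
  moreover have "(\<Sum>\<gamma>'\<in>dual_coset G H \<gamma>. \<xi> \<gamma>' a) = 0" if "\<gamma> \<in> characters G" "a \<in> A" for \<gamma> a
  proof -
    have "a \<notin> H" using s that unfolding spread_def by blast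
    thus ?thesis
      using sum_dual_coset[OF that(1) AG[OF that(2)]] by (simp add: \<xi>_def flip: sum_divide_distrib)
  qed
  ultimately show ?thesis using spectral_unbiased[OF assms] unfolding simplices_def by blast
qed

lemma simplices_imp_spread:
  assumes simplices shows spread
proof -
  let ?one = "\<lambda>g\<in>carrier G. 1 :: complex"
  note one = characters_one
  have disj: "a \<notin> H" if a: "a \<in> A" for a
  proof
    assume aH: "a \<in> H"
    \<comment> \<open>All characters in the annihilator equal 1 at a point of \<open>H\<close>, so
      the vectors of this simplex could not sum to zero there.\<close>
    have "0 = (\<Sum>\<gamma>'\<in>dual_coset G H ?one. \<xi> \<gamma>' a)" using assms a one unfolding simplices_def by simp
    also have "\<dots> = (\<Sum>\<gamma>'\<in>dual_coset G H ?one. \<gamma>' a) / of_real (sqrt (real S))"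
      by (simp add: \<xi>_def sum_divide_distrib)
    finally have "(\<Sum>\<gamma>'\<in>dual_coset G H ?one. \<gamma>' a) = 0" using S_pos by simp
    thus False using sum_dual_coset[OF one AG[OF a]] aH AG[OF a] by (simp flip: of_nat_Suc)
  qed
  obtain C where C: "\<And>x. C * (norm_on A x)\<^sup>2 =
      (\<Sum>n\<in>dual_coset G H ?one. (cmod (inner_on A (\<xi> n) x))\<^sup>2)"
    using assms one unfolding simplices_def regular_simplex_def is_ETF_def by blast
  have inner: "inner_on A (\<xi> n) (indicator B) = (\<Sum>a\<in>B. cnj (\<xi> n a))" if "B \<subseteq> A" for n B
    unfolding inner_on_def by (rule sum.mono_neutral_cong_right[OF finite_A that]) auto
  have nrm: "(norm_on A (indicator B))\<^sup>2 = real (card B)" if "B \<subseteq> A" for B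
  proof -
    have "(\<Sum>a\<in>A. (cmod (indicator B a))\<^sup>2) = (\<Sum>a\<in>B. 1)"
      by (rule sum.mono_neutral_cong_right[OF finite_A that]) auto
    thus ?thesis by (simp add: norm_on_eq)
  qed
  have "a = a'" if a: "a \<in> A" "a' \<in> A" "a \<otimes> inv a' \<in> H" for a a'
  proof (rule ccontr)
    assume ne: "a \<noteq> a'"
    \<comment> \<open>Members of the annihilator are trivial on the difference of \<open>a\<close>
      and \<open>a'\<close>, so they cannot tell the two apart.\<close>
    have n: "n a' = n a" "cmod (n a) = 1" if n: "n \<in> dual_coset G H ?one" for n
    proof -
      have "n \<in> characters G" "n (a \<otimes> inv a') = 1"
        using n a(3) HG by (simp_all add: dual_coset_eq[OF H one])
      hence *: "n \<in> hom G circle_group" "n (a \<otimes> inv a') = 1" using characters_hom by blast+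
      have "n a = n (a \<otimes> inv a' \<otimes> a')" using a AG by (simp add: m_assoc)
      also have "\<dots> = n a'" using * a AG by (simp only: hom_circle_mult[OF *(1)] m_closed inv_closed) simp
      finally show "n a' = n a" ..
      show "cmod (n a) = 1" using hom_circle_norm[OF *(1)] a AG by blast
    qed
    \<comment> \<open>The test vector supported at \<open>a\<close> determines the frame
      constant.\<close>
    have "C = (\<Sum>n\<in>dual_coset G H ?one. (cmod (cnj (\<xi> n a)))\<^sup>2)"
      using C[of "indicator {a}"] inner[of "{a}"] nrm[of "{a}"] a by simp
    also have "\<dots> = (\<Sum>n\<in>dual_coset G H ?one. 1 / real S)"
      by (intro sum.cong refl) (simp add: \<xi>_def norm_mult norm_divide power_divide n)
    also have "\<dots> = (real S + 1) / real S" by (simp add: card_dual_coset[OF one] add.commute)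
    finally have C1: "C = (real S + 1) / real S" .
    \<comment> \<open>The test vector supported at \<open>a\<close> and \<open>a'\<close> has
      squared norm 2, but equal contributions add up to quadruple the frame sum, which contradicts
      the value of \<open>C\<close>.\<close>
    have "C * 2 = (\<Sum>n\<in>dual_coset G H ?one. (cmod (cnj (\<xi> n a) + cnj (\<xi> n a')))\<^sup>2)"
      using C[of "indicator {a, a'}"] inner[of "{a, a'}"] nrm[of "{a, a'}"] a ne by simp
    also have "\<dots> = (\<Sum>n\<in>dual_coset G H ?one. 4 / real S)"
    proof (intro sum.cong refl)
      fix m assume m: "m \<in> dual_coset G H ?one"
      have "cnj (\<xi> m a) + cnj (\<xi> m a') = 2 * cnj (\<xi> m a)" using n(1)[OF m] by (simp add: \<xi>_def)
      thus "(cmod (cnj (\<xi> m a) + cnj (\<xi> m a')))\<^sup>2 = 4 / real S"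
        by (simp add: \<xi>_def norm_mult norm_divide power_mult_distrib power_divide n(2)[OF m])
    qed
    also have "\<dots> = 4 * ((real S + 1) / real S)" by (simp add: card_dual_coset[OF one] add.commute)
    finally show False using C1 S_pos by simp
  qed
  thus ?thesis using disj unfolding spread_def by blast
qed

text \<open>Orthogonality leaves only the difference count at the identity, which is
  \<open>S\<close>.\<close>

lemma parseval:
  "(\<Sum>\<gamma>\<in>characters G. (cmod (\<Sum>a\<in>A. \<gamma> a))\<^sup>2) = real (order G) * real S"
proof -
  have "of_real (\<Sum>\<gamma>\<in>characters G. (cmod (\<Sum>a\<in>A. \<gamma> a))\<^sup>2) =
      (\<Sum>\<gamma>\<in>characters G. \<Sum>g\<in>carrier G. of_nat (num_differences G A g) * \<gamma> g)"
    unfolding of_real_sum by (intro sum.cong refl norm_sum_hom_circle[OF A] characters_hom)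
  also have "\<dots> = (\<Sum>g\<in>carrier G. of_nat (num_differences G A g) * (\<Sum>\<gamma>\<in>characters G. \<gamma> g))"
    by (subst sum.swap) (simp add: sum_distrib_left)
  also have "\<dots> = (\<Sum>g\<in>carrier G. if g = \<one> then of_nat (num_differences G A g) * of_nat (order G) else 0)"
    by (intro sum.cong refl) (simp add: sum_characters)
  also have "\<dots> = of_real (real (order G) * real S)"
    by (simp add: num_differences_one[OF A] card_A mult.commute)
  finally show ?thesis using of_real_eq_iff by blast
qed

text \<open>Off the annihilator all character sums share the modulus \<open>S * c\<close>, by
  comparison with the trivial character. On it they are known from \<open>spread\<close>, so
  \<open>parseval\<close> determines the common modulus.\<close>

lemma simplices_imp_spectral:
  assumes simplices shows spectral
proof -
  let ?one = "\<lambda>g\<in>carrier G. 1 :: complex"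
  have ann: "(\<Sum>a\<in>A. \<gamma> a) = -1" if "\<gamma> \<in> annihilator G H" "\<gamma> \<noteq> ?one" for \<gamma>
    using sum_annihilator_spread[OF simplices_imp_spread[OF assms] that] .
  obtain c where "\<forall>\<gamma>\<in>characters G. \<forall>\<gamma>'\<in>characters G.
      dual_coset G H \<gamma> \<noteq> dual_coset G H \<gamma>' \<longrightarrow> cmod (inner_on A (\<xi> \<gamma>) (\<xi> \<gamma>')) = c"
    using conjunct2[OF assms[unfolded simplices_def]] by (elim exE)
  hence c: "cmod (inner_on A (\<xi> \<gamma>) (\<xi> \<gamma>')) = c" if "\<gamma> \<in> characters G" "\<gamma>' \<in> characters G"
      "dual_coset G H \<gamma> \<noteq> dual_coset G H \<gamma>'" for \<gamma> \<gamma>' using that by simp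
  define N where "N = characters G - annihilator G H"
  have k: "cmod (\<Sum>a\<in>A. \<gamma> a) = real S * c" if \<gamma>: "\<gamma> \<in> N" for \<gamma>
  proof -
    have \<gamma>': "\<gamma> \<in> characters G" using \<gamma> N_def by blast
    have "dual_coset G H ?one \<noteq> dual_coset G H \<gamma>"
      unfolding dual_coset_eq_iff[OF H characters_one \<gamma>'] using \<gamma> HG
      by (auto simp: N_def annihilator_iff)
    hence "cmod (inner_on A (\<xi> ?one) (\<xi> \<gamma>)) = c" using c characters_one \<gamma>' by blast
    thus ?thesis unfolding inner_on_\<xi> using AG S_pos by (simp add: norm_divide field_simps)
  qed
  have cardN: "real (card N) = real (order G) - (real S + 1)"
  proof -
    have sub: "annihilator G H \<subseteq> characters G" by (auto simp: annihilator_iff)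
    have "card (characters G) = order G"
      using card_annihilator[OF triv_subgroup] by (simp add: annihilator_one)
    moreover have "card (annihilator G H) \<le> card (characters G)"
      by (rule card_mono[OF finite_characters sub])
    ultimately show ?thesis
      unfolding N_def card_Diff_subset[OF finite_annihilator sub] by (simp add: card_annihilator_H)
  qed
  have "real (order G) * real S =
      (\<Sum>\<gamma>\<in>N. (cmod (\<Sum>a\<in>A. \<gamma> a))\<^sup>2) + (\<Sum>\<gamma>\<in>annihilator G H. (cmod (\<Sum>a\<in>A. \<gamma> a))\<^sup>2)"
    unfolding parseval[symmetric] N_def
    by (rule sum.subset_diff) (auto simp: annihilator_iff finite_characters)
  also have "(\<Sum>\<gamma>\<in>annihilator G H. (cmod (\<Sum>a\<in>A. \<gamma> a))\<^sup>2) = (real S)\<^sup>2 + real S"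
  proof -
    have "(\<Sum>\<gamma>\<in>annihilator G H. (cmod (\<Sum>a\<in>A. \<gamma> a))\<^sup>2) =
        (cmod (\<Sum>a\<in>A. ?one a))\<^sup>2 + (\<Sum>\<gamma>\<in>annihilator G H - {?one}. (cmod (\<Sum>a\<in>A. \<gamma> a))\<^sup>2)"
      by (rule sum.remove[OF finite_annihilator one_in_annihilator])
    also have "(\<Sum>\<gamma>\<in>annihilator G H - {?one}. (cmod (\<Sum>a\<in>A. \<gamma> a))\<^sup>2) = (\<Sum>\<gamma>\<in>annihilator G H - {?one}. 1)"
      by (intro sum.cong refl) (simp add: ann)
    also have "\<dots> = real S"
      using one_in_annihilator card_annihilator_H finite_annihilator by simp
    finally show ?thesis unfolding sum_A_one by simp
  qed
  also have "(\<Sum>\<gamma>\<in>N. (cmod (\<Sum>a\<in>A. \<gamma> a))\<^sup>2) = real (card N) * (real S * c)\<^sup>2"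
    by (simp add: k)
  finally have "real (card N) * (real S * c)\<^sup>2 = real (card N) * real S"
    unfolding cardN by (simp add: algebra_simps power2_eq_square)
  \<comment> \<open>The factor \<open>card N\<close> is cancelled only in the presence of a member
    of \<open>N\<close>; for empty \<open>N\<close> the claim is vacuous.\<close>
  moreover have "card N > 0" if "\<gamma> \<in> N" for \<gamma>
    using that finite_characters by (auto simp: N_def card_gt_0_iff)
  ultimately have sq: "(real S * c)\<^sup>2 = real S" if "\<gamma> \<in> N" for \<gamma> using that by fastforce
  have "cmod (\<Sum>a\<in>A. \<gamma> a) = sqrt (real S)" if "\<gamma> \<in> N" for \<gamma>
  proof -
    have "(cmod (\<Sum>a\<in>A. \<gamma> a))\<^sup>2 = real S" using k[OF that] sq[OF that] by simp
    thus ?thesis by (metis norm_ge_zero real_sqrt_unique)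
  qed
  thus ?thesis using ann unfolding spectral_def N_def by blast
qed

subsection \<open>Conference matrices\<close>

lemma normal_H: "H \<lhd> G"
  using H normal_iff_subgroup by blast

lemma rcos_eq_H_iff: "x \<in> carrier G \<Longrightarrow> H #> x = H \<longleftrightarrow> x \<in> H"
  using coset_join1[OF _ _ H] coset_join2[OF _ H] by blast

lemma rcos_subgroup_mult: "h \<in> H \<Longrightarrow> x \<in> carrier G \<Longrightarrow> H #> (h \<otimes> x) = H #> x"
  using coset_mult_assoc[OF subgroup.subset[OF H], of h x] HG subgroup.rcos_const[OF H is_group]
  by simp

lemma carrier_Mod [simp]: "carrier (G Mod H) = rcosets H"
  by (simp add: FactGroup_def)

lemma rcos_closed: "x \<in> carrier G \<Longrightarrow> H #> x \<in> rcosets H"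
  using rcosetsI[OF subgroup.subset[OF H]] .

text \<open>Makes every off-diagonal entry of \<open>C_hat\<close> a sum with a single term.\<close>

lemma spread_unique_in_coset:
  assumes spread "K \<in> rcosets H" "K \<noteq> H"
  obtains a where "a \<in> A" "{a \<in> A. H #> a = K} = {a}"
proof -
  obtain x where x: "x \<in> carrier G" "K = H #> x" using assms(2) by (auto simp: RCOSETS_def)
  have "x \<in> carrier G - H" using x assms(3) rcos_eq_H_iff by blast
  hence "x \<in> (\<lambda>(a, h). h \<otimes> a) ` (A \<times> H)"
    using bij_betw_imp_surj_on[OF bij_betw_spread[OF assms(1)]] by blast
  then obtain a h where ah: "a \<in> A" "h \<in> H" "x = h \<otimes> a" by auto
  have K: "K = H #> a" using x ah rcos_subgroup_mult AG by simp
  have "a' = a" if "a' \<in> A" "H #> a' = K" for a'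
  proof -
    have "H #> a' = H #> a" using that K by simp
    hence "H #> (a' \<otimes> inv a) = H"
      by (rule coset_mult_inv2[OF _ AG[OF that(1)] AG[OF ah(1)] subgroup.subset[OF H]])
    moreover have "a' \<otimes> inv a \<in> carrier G" using AG that(1) ah(1) by simp
    ultimately have "a' \<otimes> inv a \<in> H" using rcos_eq_H_iff by simp
    thus ?thesis using assms(1) that(1) ah(1) unfolding spread_def by simp
  qed
  hence "{a \<in> A. H #> a = K} = {a}" using K ah(1) by auto
  thus thesis by (rule that[OF ah(1)])
qed

text \<open>Terms are moved across the equation in the abelian quotient. The right-hand form says
  that \<open>a\<close> in column \<open>X\<close> and \<open>a'\<close> in column \<open>Y\<close>
  belong to the same row.\<close>

lemma rcos_diff_eq_iff:
  assumes a: "a \<in> carrier G" "a' \<in> carrier G" and X: "X \<in> rcosets H" "Y \<in> rcosets H"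
  shows "H #> (a' \<otimes> inv a) = X \<otimes>\<^bsub>G Mod H\<^esub> inv\<^bsub>G Mod H\<^esub> Y \<longleftrightarrow>
    (H #> a) \<otimes>\<^bsub>G Mod H\<^esub> X = (H #> a') \<otimes>\<^bsub>G Mod H\<^esub> Y"
proof -
  interpret Q: comm_group "G Mod H" using abelian_FactGroup[OF H] .
  have hom: "(\<lambda>a. H #> a) \<in> hom G (G Mod H)" using normal.r_coset_hom_Mod[OF normal_H] .
  have Q: "H #> a \<in> carrier (G Mod H)" "H #> a' \<in> carrier (G Mod H)"
    "X \<in> carrier (G Mod H)" "Y \<in> carrier (G Mod H)"
    using a X rcos_closed by simp_all
  interpret f: group_hom G "G Mod H" "\<lambda>a. H #> a"
    using hom by unfold_locales
  have eq: "H #> (a' \<otimes> inv a) = (H #> a') \<otimes>\<^bsub>G Mod H\<^esub> inv\<^bsub>G Mod H\<^esub> (H #> a)"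
    using f.hom_mult[of a' "inv a"] f.hom_inv[of a] a by simp
  have "(H #> a') \<otimes>\<^bsub>G Mod H\<^esub> inv\<^bsub>G Mod H\<^esub> (H #> a) = X \<otimes>\<^bsub>G Mod H\<^esub> inv\<^bsub>G Mod H\<^esub> Y \<longleftrightarrow>
      H #> a' = X \<otimes>\<^bsub>G Mod H\<^esub> inv\<^bsub>G Mod H\<^esub> Y \<otimes>\<^bsub>G Mod H\<^esub> (H #> a)"
    using Q.inv_solve_right'[of "X \<otimes>\<^bsub>G Mod H\<^esub> inv\<^bsub>G Mod H\<^esub> Y" "H #> a'" "H #> a"] Q
    by (metis Q.inv_closed Q.m_closed)
  also have "X \<otimes>\<^bsub>G Mod H\<^esub> inv\<^bsub>G Mod H\<^esub> Y \<otimes>\<^bsub>G Mod H\<^esub> (H #> a) =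
      ((H #> a) \<otimes>\<^bsub>G Mod H\<^esub> X) \<otimes>\<^bsub>G Mod H\<^esub> inv\<^bsub>G Mod H\<^esub> Y"
    using Q by (metis Q.inv_closed Q.m_closed Q.m_assoc Q.m_comm)
  also have "H #> a' = \<dots> \<longleftrightarrow> (H #> a) \<otimes>\<^bsub>G Mod H\<^esub> X = (H #> a') \<otimes>\<^bsub>G Mod H\<^esub> Y"
    using Q by (metis Q.inv_solve_right Q.m_closed)
  finally show ?thesis unfolding eq .
qed

text \<open>A pair \<open>a\<close>, \<open>a'\<close> contributes to the Gram sum exactly when its
  difference lies in the coset \<open>X - Y\<close>, and then contributes
  \<open>\<gamma> (a' \<otimes> inv a)\<close>; grouping by differences gives the counts.\<close>

lemma sum_C_hat:
  assumes X: "X \<in> rcosets H" "Y \<in> rcosets H" and \<gamma>: "\<gamma> \<in> hom G circle_group"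
  shows "(\<Sum>Z\<in>rcosets H. cnj (C_hat G H A \<gamma> Z X) * C_hat G H A \<gamma> Z Y) =
    (\<Sum>g\<in>carrier G. of_nat (num_differences G A g) *
       (if H #> g = X \<otimes>\<^bsub>G Mod H\<^esub> inv\<^bsub>G Mod H\<^esub> Y then \<gamma> g else 0))"
proof -
  interpret Q: comm_group "G Mod H" using abelian_FactGroup[OF H] .
  have finQ: "finite (rcosets H)" using finite_carrier by (simp add: RCOSETS_def)
  \<comment> \<open>The coset condition is solved for the row \<open>Z\<close>, so that the sum over
    rows collapses to one term.\<close>
  have C: "C_hat G H A \<gamma> Z W = (\<Sum>a\<in>A. if Z = (H #> a) \<otimes>\<^bsub>G Mod H\<^esub> W then \<gamma> a else 0)"
    if "Z \<in> rcosets H" "W \<in> rcosets H" for Z W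
  proof -
    have "H #> a = Z \<otimes>\<^bsub>G Mod H\<^esub> inv\<^bsub>G Mod H\<^esub> W \<longleftrightarrow> Z = (H #> a) \<otimes>\<^bsub>G Mod H\<^esub> W"
      if "a \<in> A" for a
      using Q.inv_solve_right[of "H #> a" Z W] that \<open>Z \<in> _\<close> \<open>W \<in> _\<close> rcos_closed AG by auto
    hence "{a \<in> A. H #> a = Z \<otimes>\<^bsub>G Mod H\<^esub> inv\<^bsub>G Mod H\<^esub> W} =
        {a \<in> A. Z = (H #> a) \<otimes>\<^bsub>G Mod H\<^esub> W}" by blast
    thus ?thesis unfolding C_hat_def by (simp only: sum.inter_filter[OF finite_A])
  qed
  have "(\<Sum>Z\<in>rcosets H. cnj (C_hat G H A \<gamma> Z X) * C_hat G H A \<gamma> Z Y) =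
      (\<Sum>Z\<in>rcosets H. \<Sum>a\<in>A. \<Sum>a'\<in>A. if Z = (H #> a) \<otimes>\<^bsub>G Mod H\<^esub> X
         then (if (H #> a) \<otimes>\<^bsub>G Mod H\<^esub> X = (H #> a') \<otimes>\<^bsub>G Mod H\<^esub> Y then cnj (\<gamma> a) * \<gamma> a' else 0) else 0)"
    using X by (intro sum.cong refl) (auto simp: C sum_product intro!: sum.cong)
  also have "\<dots> = (\<Sum>a\<in>A. \<Sum>a'\<in>A. \<Sum>Z\<in>rcosets H. if Z = (H #> a) \<otimes>\<^bsub>G Mod H\<^esub> X
         then (if (H #> a) \<otimes>\<^bsub>G Mod H\<^esub> X = (H #> a') \<otimes>\<^bsub>G Mod H\<^esub> Y then cnj (\<gamma> a) * \<gamma> a' else 0) else 0)"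
    by (subst sum.swap, intro sum.cong refl, rule sum.swap)
  also have "\<dots> = (\<Sum>a\<in>A. \<Sum>a'\<in>A.
      if (H #> a) \<otimes>\<^bsub>G Mod H\<^esub> X = (H #> a') \<otimes>\<^bsub>G Mod H\<^esub> Y then cnj (\<gamma> a) * \<gamma> a' else 0)"
  proof (intro sum.cong refl)
    fix a a' assume "a \<in> A"
    hence "(H #> a) \<otimes>\<^bsub>G Mod H\<^esub> X \<in> rcosets H"
      using Q.m_closed[of "H #> a" X] X rcos_closed AG unfolding carrier_Mod by blast
    thus "(\<Sum>Z\<in>rcosets H. if Z = (H #> a) \<otimes>\<^bsub>G Mod H\<^esub> X
         then (if (H #> a) \<otimes>\<^bsub>G Mod H\<^esub> X = (H #> a') \<otimes>\<^bsub>G Mod H\<^esub> Y then cnj (\<gamma> a) * \<gamma> a' else 0) else 0) =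
         (if (H #> a) \<otimes>\<^bsub>G Mod H\<^esub> X = (H #> a') \<otimes>\<^bsub>G Mod H\<^esub> Y then cnj (\<gamma> a) * \<gamma> a' else 0)"
      using finQ by (simp only: sum.delta if_True)
  qed
  also have "\<dots> = (\<Sum>a\<in>A. \<Sum>a'\<in>A.
      if H #> (a' \<otimes> inv a) = X \<otimes>\<^bsub>G Mod H\<^esub> inv\<^bsub>G Mod H\<^esub> Y then \<gamma> (a' \<otimes> inv a) else 0)"
    using AG rcos_diff_eq_iff[OF _ _ X] hom_circle_diff[OF \<gamma>]
    by (intro sum.cong refl) (simp add: mult.commute)
  also have "\<dots> = (\<Sum>a'\<in>A. \<Sum>a\<in>A.
      if H #> (a' \<otimes> inv a) = X \<otimes>\<^bsub>G Mod H\<^esub> inv\<^bsub>G Mod H\<^esub> Y then \<gamma> (a' \<otimes> inv a) else 0)"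
    by (rule sum.swap)
  finally show ?thesis
    using sum_num_differences[OF A, of "\<lambda>g. if H #> g = X \<otimes>\<^bsub>G Mod H\<^esub> inv\<^bsub>G Mod H\<^esub> Y then \<gamma> g else 0"]
    by simp
qed

text \<open>The diagonal vanishes because \<open>A\<close> misses \<open>H\<close>, and off-diagonal
  entries are single character values. In the Gram sum the counts leave \<open>S\<close> at the
  identity plus a multiple of a sum over a union of cosets of \<open>H\<close>.\<close>

lemma circulant_conference_matrix_C_hat:
  assumes "simplicial_RDS G H A" and \<gamma>: "\<gamma> \<in> characters G - annihilator G H"
  shows "circulant_conference_matrix (G Mod H) S (C_hat G H A \<gamma>)"
proof -
  interpret Q: comm_group "G Mod H" using abelian_FactGroup[OF H] .
  obtain \<Lambda> where s: spread and \<Lambda>: "\<And>g. g \<in> carrier G - H \<Longrightarrow> num_differences G A g = \<Lambda>"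
    using assms(1) unfolding simplicial_RDS_iff by blast
  have h: "\<gamma> \<in> hom G circle_group" using \<gamma> characters_hom by blast
  have diff: "X \<otimes>\<^bsub>G Mod H\<^esub> inv\<^bsub>G Mod H\<^esub> Y \<in> rcosets H"
    "X \<otimes>\<^bsub>G Mod H\<^esub> inv\<^bsub>G Mod H\<^esub> Y = H \<longleftrightarrow> X = Y" if "X \<in> rcosets H" "Y \<in> rcosets H" for X Y
  proof -
    have XY: "X \<in> carrier (G Mod H)" "Y \<in> carrier (G Mod H)" using that by simp_all
    show "X \<otimes>\<^bsub>G Mod H\<^esub> inv\<^bsub>G Mod H\<^esub> Y \<in> rcosets H"
      using Q.m_closed[OF XY(1) Q.inv_closed[OF XY(2)]] unfolding carrier_Mod .
    have "X \<otimes>\<^bsub>G Mod H\<^esub> inv\<^bsub>G Mod H\<^esub> Y = \<one>\<^bsub>G Mod H\<^esub> \<longleftrightarrow> X = Y"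
      using XY by (metis Q.inv_closed Q.inv_equality Q.inv_inv Q.r_inv)
    thus "X \<otimes>\<^bsub>G Mod H\<^esub> inv\<^bsub>G Mod H\<^esub> Y = H \<longleftrightarrow> X = Y" by simp
  qed
  have "card (rcosets H) * card H = (S + 1) * card H"
    using lagrange[OF H] order_eq by (metis mult.commute)
  hence card: "order (G Mod H) = S + 1"
    unfolding order_def carrier_Mod using card_H_pos by (metis less_numeral_extra(3) mult_right_cancel)
  have diag: "C_hat G H A \<gamma> X X = 0" if "X \<in> rcosets H" for X
  proof -
    have "X \<otimes>\<^bsub>G Mod H\<^esub> inv\<^bsub>G Mod H\<^esub> X = H" using diff(2)[OF that that] by simp
    hence "H #> a \<noteq> X \<otimes>\<^bsub>G Mod H\<^esub> inv\<^bsub>G Mod H\<^esub> X" if "a \<in> A" for a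
      using s rcos_eq_H_iff[OF AG[OF that]] that unfolding spread_def by auto
    thus ?thesis unfolding C_hat_def by (intro sum.neutral) auto
  qed
  have unimod: "cmod (C_hat G H A \<gamma> X Y) = 1" if XY: "X \<in> rcosets H" "Y \<in> rcosets H" "X \<noteq> Y" for X Y
  proof -
    have "X \<otimes>\<^bsub>G Mod H\<^esub> inv\<^bsub>G Mod H\<^esub> Y \<noteq> H" using diff(2)[OF XY(1,2)] XY(3) by simp
    then obtain a where a: "a \<in> A" "{a \<in> A. H #> a = X \<otimes>\<^bsub>G Mod H\<^esub> inv\<^bsub>G Mod H\<^esub> Y} = {a}"
      by (rule spread_unique_in_coset[OF s diff(1)[OF XY(1,2)]])
    show ?thesis unfolding C_hat_def a(2) using hom_circle_norm[OF h AG[OF a(1)]] by simp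
  qed
  have gram: "(\<Sum>Z\<in>rcosets H. cnj (C_hat G H A \<gamma> Z X) * C_hat G H A \<gamma> Z Y) =
      (if X = Y then of_nat S else 0)" if XY: "X \<in> rcosets H" "Y \<in> rcosets H" for X Y
  proof -
    let ?W = "X \<otimes>\<^bsub>G Mod H\<^esub> inv\<^bsub>G Mod H\<^esub> Y"
    let ?\<phi> = "\<lambda>g. if H #> g = ?W then \<gamma> g else 0"
    \<comment> \<open>\<open>\<gamma>\<close> is nontrivial on \<open>H\<close>, hence sums to zero
      over each coset of \<open>H\<close>, while the condition on \<open>g\<close> depends only on
      its coset.\<close>
    have outside: "(\<Sum>g\<in>carrier G - H. ?\<phi> g) = 0"
    proof -
      have "(\<Sum>g\<in>carrier G - H. ?\<phi> g) = (\<Sum>a\<in>A. \<Sum>h\<in>H. \<gamma> h * (if H #> a = ?W then \<gamma> a else 0))"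
        unfolding sum_outside_H[OF s] using AG HG
        by (intro sum.cong refl) (simp add: rcos_subgroup_mult hom_circle_mult[OF h])
      also have "\<dots> = 0" by (simp add: sums_not_annihilator(1)[OF \<gamma>] flip: sum_distrib_right)
      finally show ?thesis .
    qed
    have "?\<phi> \<one> = (if X = Y then 1 else 0)"
      using diff(2)[OF XY] hom_circle_one[OF h] coset_mult_one[OF subgroup.subset[OF H]] by auto
    moreover have "(\<Sum>Z\<in>rcosets H. cnj (C_hat G H A \<gamma> Z X) * C_hat G H A \<gamma> Z Y) =
        of_nat S * ?\<phi> \<one> + of_nat \<Lambda> * (\<Sum>g\<in>carrier G - H. ?\<phi> g)"
      unfolding sum_C_hat[OF XY h] by (rule sum_num_differences_RDS[OF s]) (rule \<Lambda>)
    ultimately show ?thesis unfolding outside by simp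
  qed
  have circ: "\<exists>f. \<forall>X\<in>rcosets H. \<forall>Y\<in>rcosets H. C_hat G H A \<gamma> X Y = f (X \<otimes>\<^bsub>G Mod H\<^esub> inv\<^bsub>G Mod H\<^esub> Y)"
    by (rule exI[of _ "\<lambda>Z. \<Sum>a\<in>{a \<in> A. H #> a = Z}. \<gamma> a"]) (simp add: C_hat_def)
  show ?thesis
    unfolding circulant_conference_matrix_def carrier_Mod
    by (intro conjI ballI impI card circ diag unimod gram)
qed

section \<open>Composite difference sets\<close>

lemma sum_convolution:
  assumes D: "D \<subseteq> carrier G" and B: "B \<subseteq> carrier G"
    and conv: "\<And>g. g \<in> carrier G \<Longrightarrow> indicator D g = convolution G (indicator A) (indicator B) g"
  shows "(\<Sum>d\<in>D. \<phi> d) = (\<Sum>a\<in>A. \<Sum>b\<in>B. \<phi> (b \<otimes> a) :: complex)"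
proof -
  have ind: "(\<Sum>g\<in>carrier G. indicator E g * \<psi> g) = (\<Sum>g\<in>E. \<psi> g)" if "E \<subseteq> carrier G"
    for E and \<psi> :: "'a \<Rightarrow> complex"
    by (rule sum.mono_neutral_cong_right[OF finite_carrier that]) auto
  have "(\<Sum>d\<in>D. \<phi> d) = (\<Sum>g\<in>carrier G. indicator D g * \<phi> g)" using ind[OF D] by simp
  also have "\<dots> = (\<Sum>g\<in>carrier G. \<Sum>a\<in>carrier G. indicator A a * (indicator B (g \<otimes> inv a) * \<phi> g))"
    by (intro sum.cong refl) (simp add: conv convolution_def sum_distrib_right mult.assoc)
  also have "\<dots> = (\<Sum>a\<in>carrier G. indicator A a * (\<Sum>g\<in>carrier G. indicator B (g \<otimes> inv a) * \<phi> g))"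
    by (subst sum.swap) (simp add: sum_distrib_left)
  also have "\<dots> = (\<Sum>a\<in>A. \<Sum>g\<in>carrier G. indicator B (g \<otimes> inv a) * \<phi> g)" by (rule ind[OF A])
  \<comment> \<open>For fixed \<open>a\<close> the substitution \<open>g = b \<otimes> a\<close>
    undoes the shift in the convolution.\<close>
  also have "\<dots> = (\<Sum>a\<in>A. \<Sum>b\<in>carrier G. indicator B b * \<phi> (b \<otimes> a))"
  proof (rule sum.cong[OF refl])
    fix a assume "a \<in> A"
    hence a: "a \<in> carrier G" by (rule AG)
    show "(\<Sum>g\<in>carrier G. indicator B (g \<otimes> inv a) * \<phi> g) = (\<Sum>b\<in>carrier G. indicator B b * \<phi> (b \<otimes> a))"
      by (rule sum.reindex_bij_witness[of _ "\<lambda>b. b \<otimes> a" "\<lambda>g. g \<otimes> inv a"])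
         (use a in \<open>auto simp: m_assoc\<close>)
  qed
  also have "\<dots> = (\<Sum>a\<in>A. \<Sum>b\<in>B. \<phi> (b \<otimes> a))" by (simp only: ind[OF B])
  finally show ?thesis .
qed

text \<open>The part of the character sum over \<open>D\<close> in a coset of \<open>H\<close> is
  the sum over \<open>B\<close> times the corresponding part of the sum over \<open>A\<close>. The
  common factor has modulus 1 because fineness ties \<open>card B\<close> to \<open>S\<close> and
  \<open>card H\<close>, and the difference set identity for \<open>B\<close> then fixes the modulus
  of its character sum.\<close>

lemma composite_C_hat:
  assumes fine: "fine_difference_set G H D"
    and B: "difference_set (G\<lparr>carrier := H\<rparr>) B"
    and conv: "\<And>g. g \<in> carrier G \<Longrightarrow> indicator D g = convolution G (indicator A) (indicator B) g"
    and \<gamma>: "\<gamma> \<in> characters G - annihilator G H"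
  obtains u where "cmod u = 1" "\<And>X Y. C_hat G H A \<gamma> X Y = u * C_mat G H S D \<gamma> X Y"
proof -
  have h: "\<gamma> \<in> hom G circle_group" using \<gamma> characters_hom by blast
  have BH: "B \<subseteq> H" using B by (simp add: difference_set_def)
  hence BG: "B \<subseteq> carrier G" using HG by blast
  have DG: "D \<subseteq> carrier G" and D0: "D \<noteq> {}" and DH: "D \<inter> H = {}"
    using fine by (auto simp: fine_difference_set_def difference_set_def)
  note sumD = sum_convolution[OF DG BG conv]
  define s b q where "s = real S" and "b = real (card B)" and "q = real (card H)"
  \<comment> \<open>The constant function 1 in the convolution identity compares
    cardinalities.\<close>
  have "complex_of_nat (card D) = of_nat (S * card B)" using sumD[of "\<lambda>_. 1"] by (simp add: card_A)
  hence cardD: "real (card D) = s * b" unfolding s_def b_def by (metis of_nat_eq_iff of_nat_mult)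
  have q: "q > 0" using card_H_pos by (simp add: q_def)
  have s: "s > 0" using S_pos by (simp add: s_def)
  have ord: "real (order G) = q * (s + 1)" by (simp add: order_eq q_def s_def algebra_simps)
  have finD: "finite D" using finite_subset[OF DG] by simp
  have Dpos: "s * b > 0" using cardD D0 finD by (metis card_gt_0_iff of_nat_0_less_iff)
  \<comment> \<open>\<open>D\<close> misses the identity, which lies in \<open>H\<close>; this makes
    the denominator under the square root positive.\<close>
  have "card D < order G"
    unfolding order_def
    by (rule psubset_card_mono) (use DG DH subgroup.one_closed[OF H] in auto)
  hence lt: "s * b < q * (s + 1)" using cardD ord by (metis of_nat_less_iff)
  let ?S = "sqrt (s * b * (q * (s + 1) - 1) / (q * (s + 1) - s * b))"
  have "q = q * (s + 1) / (?S + 1)"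
    using fine unfolding fine_difference_set_def cardD ord q_def[symmetric] by (simp only: Let_def)
  \<comment> \<open>Division by zero gives zero, so a vanishing denominator would force
    \<open>q = 0\<close>.\<close>
  moreover have S0: "?S + 1 \<noteq> 0"
  proof
    assume "?S + 1 = 0"
    hence "q = 0" using calculation by simp
    thus False using q by simp
  qed
  ultimately have "q * (?S + 1) = q * (s + 1)" by (metis nonzero_eq_divide_eq)
  hence "?S = s" using q by simp
  hence "s * b * (q * (s + 1) - 1) / (q * (s + 1) - s * b) = s\<^sup>2"
    using s by (metis less_eq_real_def real_sqrt_eq_iff real_sqrt_unique real_sqrt_abs abs_of_pos)
  hence "s * b * (q * (s + 1) - 1) = s\<^sup>2 * (q * (s + 1) - s * b)" using lt by (simp add: field_simps)
  hence "s * (b * (q * (s + 1) - 1)) = s * (s * (q * (s + 1) - s * b))"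
    by (simp add: power2_eq_square mult.assoc)
  hence "b * (q * (s + 1) - 1) = s * (q * (s + 1) - s * b)" using s by simp
  \<comment> \<open>The fineness equation acquires the common factor \<open>s + 1\<close> after
    rearrangement; cancelling it yields the relation \<open>key\<close> between \<open>b\<close>,
    \<open>s\<close> and \<open>q\<close>.\<close>
  hence "(s + 1) * (s * (q - b)) = (s + 1) * (b * (q - 1))" by (simp add: algebra_simps)
  hence key: "s * (q - b) = b * (q - 1)" using s by simp
  define \<beta> where "\<beta> = (\<Sum>b\<in>B. \<gamma> b)"
  obtain k where k: "k \<in> H" "\<gamma> k \<noteq> 1" using \<gamma> by (auto simp: annihilator_iff)
  have \<beta>1: "(cmod \<beta>)\<^sup>2 * (q - 1) = b * (q - b)"
    using finite_comm_group.norm_sum_difference_set[OF subgroup_finite_comm_group[OF H] B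
        hom_circle_subgroup[OF H h], of k] k
    by (simp add: \<beta>_def q_def b_def order_def)
  \<comment> \<open>\<open>q - b\<close> is eliminated between \<open>\<beta>1\<close> and
    \<open>key\<close>; the factor \<open>q - 1\<close> cancels because \<open>H\<close> carries a
    nontrivial character.\<close>
  have "s * (cmod \<beta>)\<^sup>2 * (q - 1) = b * (s * (q - b))" using \<beta>1 by simp
  also have "\<dots> = b\<^sup>2 * (q - 1)" unfolding key by (simp add: power2_eq_square)
  finally have "(s * (cmod \<beta>)\<^sup>2 - b\<^sup>2) * (q - 1) = 0" by (simp add: left_diff_distrib)
  moreover have "q \<noteq> 1"
  proof
    assume "q = 1"
    hence "card H = 1" by (simp add: q_def)
    hence "k = \<one>" using k subgroup.one_closed[OF H] by (auto simp: card_1_singleton_iff)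
    thus False using k hom_circle_one[OF h] by simp
  qed
  ultimately have \<beta>2: "s * (cmod \<beta>)\<^sup>2 = b\<^sup>2" by simp
  have b: "b > 0" using Dpos s by (simp add: zero_less_mult_iff)
  define v where "v = complex_of_real (s powr (3 / 2) / real (card D)) * \<beta>"
  have "sqrt s * cmod \<beta> = b"
  proof -
    have "(sqrt s * cmod \<beta>)\<^sup>2 = b\<^sup>2" using \<beta>2 s by (simp add: power_mult_distrib)
    thus ?thesis using b s by (simp add: power2_eq_iff_nonneg)
  qed
  \<comment> \<open>With \<open>card D = s * b\<close>, the modulus of \<open>v\<close> becomes
    \<open>s * sqrt s * cmod \<beta> / (s * b)\<close>, which is 1.\<close>
  moreover have "s powr (3 / 2) = s * sqrt s"
    using s powr_add[of s 1 "1/2"] by (simp add: powr_half_sqrt)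
  ultimately have v: "cmod v = 1"
    using s b unfolding v_def cardD by (simp add: norm_mult norm_divide)
  have C: "C_mat G H S D \<gamma> X Y = v * C_hat G H A \<gamma> X Y" for X Y
  proof -
    let ?W = "X \<otimes>\<^bsub>G Mod H\<^esub> inv\<^bsub>G Mod H\<^esub> Y"
    have "(\<Sum>d\<in>{d \<in> D. H #> d = ?W}. \<gamma> d) = (\<Sum>d\<in>D. if H #> d = ?W then \<gamma> d else 0)"
      by (rule sum.inter_filter[OF finD])
    also have "\<dots> = (\<Sum>a\<in>A. \<Sum>b\<in>B. if H #> (b \<otimes> a) = ?W then \<gamma> (b \<otimes> a) else 0)" by (rule sumD)
    \<comment> \<open>Members of \<open>B\<close> lie in \<open>H\<close> and do not change the
      coset, so \<open>\<gamma> b\<close> splits off.\<close>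
    also have "\<dots> = (\<Sum>a\<in>A. \<Sum>b\<in>B. \<gamma> b * (if H #> a = ?W then \<gamma> a else 0))"
    proof (intro sum.cong refl)
      fix a b assume "a \<in> A" "b \<in> B"
      hence "a \<in> carrier G" "b \<in> carrier G" "b \<in> H" using AG BH BG by auto
      thus "(if H #> (b \<otimes> a) = ?W then \<gamma> (b \<otimes> a) else 0) = \<gamma> b * (if H #> a = ?W then \<gamma> a else 0)"
        by (simp add: rcos_subgroup_mult hom_circle_mult[OF h])
    qed
    also have "\<dots> = \<beta> * (\<Sum>a\<in>A. if H #> a = ?W then \<gamma> a else 0)"
      unfolding \<beta>_def by (simp only: sum_distrib_left sum_distrib_right)
    also have "(\<Sum>a\<in>A. if H #> a = ?W then \<gamma> a else 0) = C_hat G H A \<gamma> X Y"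
      unfolding C_hat_def by (rule sum.inter_filter[OF finite_A, symmetric])
    finally show ?thesis unfolding C_mat_def v_def s_def by simp
  qed
  show thesis
  proof (rule that[of "inverse v"])
    show "cmod (inverse v) = 1" using v by (simp add: norm_inverse)
    show "C_hat G H A \<gamma> X Y = inverse v * C_mat G H S D \<gamma> X Y" for X Y
    proof -
      have "v \<noteq> 0" using v by auto
      thus ?thesis by (simp add: C mult.assoc[symmetric])
    qed
  qed
qed

end

section \<open>Equivalence of the three conditions and the resulting matrices\<close>

theorem theorem4p4:
  fixes G :: "('a, 'b) monoid_scheme"
    and H A :: "'a set"
    and S :: nat
    and \<xi> :: "('a \<Rightarrow> complex) \<Rightarrow> 'a \<Rightarrow> complex"
  assumes "comm_group G"
    and "finite (carrier G)"
    and "subgroup H G"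
    and "H \<noteq> carrier G"
    and "A \<subseteq> carrier G"
    and "card A = S"
    and "real S = real (order G) / real (card H) - 1"
    and xi: "\<And>\<gamma> a. \<xi> \<gamma> a = 1 / of_real (sqrt (real S)) * \<gamma> a"
  defines "cond_i \<equiv> simplicial_RDS G H A"
    and "cond_ii \<equiv>
      (\<forall>\<gamma>\<in>annihilator G H. \<gamma> \<noteq> \<one>\<^bsub>dual_group G\<^esub> \<longrightarrow> fourier_adj G (indicator A) \<gamma> = -1) \<and>
      (\<forall>\<gamma>\<in>carrier (dual_group G) - annihilator G H.
         cmod (fourier_adj G (indicator A) \<gamma>) = sqrt (real S))"
    and "cond_iii \<equiv>
      (\<forall>\<gamma>\<in>carrier (dual_group G).
         regular_simplex S A (dual_coset G H \<gamma>) \<xi> \<and>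
         (\<forall>a\<in>A. (\<Sum>\<gamma>'\<in>dual_coset G H \<gamma>. \<xi> \<gamma>' a) = 0)) \<and>
      (\<exists>c. \<forall>\<gamma>\<in>carrier (dual_group G). \<forall>\<gamma>'\<in>carrier (dual_group G).
         dual_coset G H \<gamma> \<noteq> dual_coset G H \<gamma>' \<longrightarrow> cmod (inner_on A (\<xi> \<gamma>) (\<xi> \<gamma>')) = c)"
  shows "(cond_i \<longleftrightarrow> cond_ii) \<and> (cond_ii \<longleftrightarrow> cond_iii) \<and>
    (cond_i \<longrightarrow>
      (\<forall>\<gamma>\<in>carrier (dual_group G). \<forall>\<gamma>'\<in>carrier (dual_group G).
         dual_coset G H \<gamma> \<noteq> dual_coset G H \<gamma>' \<longrightarrow>
         cmod (inner_on A (\<xi> \<gamma>) (\<xi> \<gamma>')) = 1 / sqrt (real S)) \<and>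
      (\<forall>\<gamma>\<in>carrier (dual_group G) - annihilator G H.
         circulant_conference_matrix (G Mod H) S (C_hat G H A \<gamma>))) \<and>
    (\<forall>D B. fine_difference_set G H D \<and>
       difference_set (G\<lparr>carrier := H\<rparr>) B \<and>
       (\<forall>g\<in>carrier G. indicator D g = convolution G (indicator A) (indicator B) g) \<longrightarrow>
       (\<forall>\<gamma>\<in>carrier (dual_group G) - annihilator G H.
          \<exists>u. cmod u = 1 \<and>
            (\<forall>X\<in>carrier (G Mod H). \<forall>Y\<in>carrier (G Mod H).
               C_hat G H A \<gamma> X Y = u * C_mat G H S D \<gamma> X Y)))"
proof -
  interpret finite_comm_group G
    using assms(1,2) by (simp add: finite_comm_group_def finite_comm_group_axioms_def)
  have q: "card H > 0"
    using finite_subset[OF subgroup.subset[OF assms(3)] assms(2)] subgroup.one_closed[OF assms(3)]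
    by (auto simp: card_gt_0_iff)
  hence "real (order G) = real (card H * (S + 1))" using assms(7) by (simp add: field_simps)
  hence ord: "order G = card H * (S + 1)" using of_nat_eq_iff by blast
  have "S \<noteq> 0"
  proof
    assume "S = 0"
    hence "card H = card (carrier G)" using ord by (simp add: order_def)
    thus False using card_subset_eq[OF assms(2) subgroup.subset[OF assms(3)]] assms(4) by simp
  qed
  hence "subset_modulo_subgroup G H A S"
    using assms(3,5,6) ord
    by (intro subset_modulo_subgroup.intro finite_comm_group_axioms subset_modulo_subgroup_axioms.intro)
       simp_all
  then interpret subset_modulo_subgroup G H A S .
  have \<xi>: "\<xi> = subset_modulo_subgroup.\<xi> S"
    using xi by (intro ext) (simp add: \<xi>_def)
  \<comment> \<open>Transforming an indicator gives the conjugated character sum, which links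
    condition (ii) to \<open>spectral\<close>.\<close>
  have fourier: "fourier_adj G (indicator A) \<gamma> = cnj (\<Sum>a\<in>A. \<gamma> a)" for \<gamma>
    unfolding fourier_adj_def cnj_sum
    by (rule sum.mono_neutral_cong_right[OF finite_carrier A]) auto
  have "cnj z = -1 \<longleftrightarrow> z = -1" for z by (auto simp: complex_eq_iff)
  moreover have "\<one>\<^bsub>dual_group G\<^esub> = (\<lambda>g\<in>carrier G. 1)" by (simp add: dual_group_def)
  ultimately have ii: "cond_ii \<longleftrightarrow> spectral"
    unfolding cond_ii_def spectral_def fourier by (simp only: complex_mod_cnj carrier_dual_group)
  have iii: "cond_iii \<longleftrightarrow> simplices"
    unfolding cond_iii_def simplices_def carrier_dual_group \<xi> ..
  have i_ii: "cond_i \<longleftrightarrow> spectral"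
    unfolding cond_i_def using simplicial_RDS_imp_spectral spectral_imp_simplicial_RDS by blast
  have ii_iii: "spectral \<longleftrightarrow> simplices"
    using spectral_imp_simplices simplices_imp_spectral by blast
  have unbiased: "cmod (inner_on A (\<xi> \<gamma>) (\<xi> \<gamma>')) = 1 / sqrt (real S)"
    if "cond_i" "\<gamma> \<in> characters G" "\<gamma>' \<in> characters G" "dual_coset G H \<gamma> \<noteq> dual_coset G H \<gamma>'"
    for \<gamma> \<gamma>'
    unfolding \<xi> using spectral_unbiased that i_ii by blast
  have conference: "circulant_conference_matrix (G Mod H) S (C_hat G H A \<gamma>)"
    if "cond_i" "\<gamma> \<in> characters G - annihilator G H" for \<gamma>
    using circulant_conference_matrix_C_hat that unfolding cond_i_def by blast
  have composite: "\<exists>u. cmod u = 1 \<and> (\<forall>X\<in>carrier (G Mod H). \<forall>Y\<in>carrier (G Mod H).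
      C_hat G H A \<gamma> X Y = u * C_mat G H S D \<gamma> X Y)"
    if "fine_difference_set G H D" "difference_set (G\<lparr>carrier := H\<rparr>) B"
      "\<forall>g\<in>carrier G. indicator D g = convolution G (indicator A) (indicator B) g"
      "\<gamma> \<in> characters G - annihilator G H" for D B \<gamma>
    using composite_C_hat[OF that(1,2) _ that(4)] that(3) by metis
  show ?thesis
    unfolding carrier_dual_group ii iii i_ii
    using ii_iii unbiased conference composite i_ii by blast
qed

end
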